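(* Let $k$ be a field, let $G$ be a finite simple graph without isolated vertices, with nonempty vertex set $V(G)=\{x_1,\dots,x_n\}$ and with $p$ connected components, let $R=k[x_1,\dots,x_n]$, let $I=I(G)\subseteq R$ be the edge ideal of $G$, and let $d=d(G)$ be the diameter of $G$. Then $$\operatorname{depth} R/I^3\ \geq\ \left\lceil \frac{d-7}{3}\right\rceil+p-1 .$$
   Context: Simple graph: no loops and no multiple edges. Vertices of $G$ are identified with the variables of $R$. The edge ideal $I(G)$ is the ideal of $R$ generated by the monomials $x_ix_j$ with $\{x_i,x_j\}\in E(G)$. The diameter of a connected graph is the maximum of the distances $d(u,v)$ (length of a shortest path) over all pairs of vertices; the diameter of a disconnected graph means the maximum of the diameters of its connected components. $\operatorname{depth} R/I^3$ is the maximum length of an $R/I^3$-regular sequence in $\mathfrak m=(x_1,\dots,x_n)$. *)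

theory Defs
  imports
    Complex_Main
    "HOL-Library.Poly_Mapping"
    "HOL-Library.Extended_Nat"
    "HOL-Library.Extended_Real"
    "Graph_Theory.Digraph_Component"
    "HOL-Algebra.Ideal_Product"
    "HOL-Algebra.QuotRing"
    "HOL-Algebra.Module"
begin

section \<open>Polynomial rings in a set of variables\<close>

text \<open>
  An element of type \<^typ>\<open>('v \<Rightarrow>\<^sub>0 nat) \<Rightarrow>\<^sub>0 'k\<close> is a finitely supported family of coefficients
  indexed by exponent vectors, i.e. a polynomial in variables of type \<^typ>\<open>'v\<close>.  The ring below
  is \<open>k[x | x \<in> V]\<close>, the polynomials all of whose monomials only involve variables from \<open>V\<close>.
\<close>

definition mpoly_ring :: "'v set \<Rightarrow> (('v \<Rightarrow>\<^sub>0 nat) \<Rightarrow>\<^sub>0 'k::comm_ring_1) ring" where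
  "mpoly_ring V =
     \<lparr>carrier = {f. \<forall>m \<in> Poly_Mapping.keys f. Poly_Mapping.keys m \<subseteq> V},
      monoid.mult = (*), one = 1, zero = 0, add = (+)\<rparr>"

definition var :: "'v \<Rightarrow> ('v \<Rightarrow>\<^sub>0 nat) \<Rightarrow>\<^sub>0 'k::comm_ring_1" where
  "var x = Poly_Mapping.single (Poly_Mapping.single x 1) 1"

lemma mpoly_ring_simps [simp]:
  "monoid.mult (mpoly_ring V) = (*)" "one (mpoly_ring V) = 1"
  "zero (mpoly_ring V) = 0" "add (mpoly_ring V) = (+)"
  by (simp_all add: mpoly_ring_def)

lemma mem_carrier_mpoly_ring:
  "f \<in> carrier (mpoly_ring V) \<longleftrightarrow> (\<forall>m \<in> Poly_Mapping.keys f. Poly_Mapping.keys m \<subseteq> V)"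
  by (simp add: mpoly_ring_def)

lemma cring_mpoly_ring: "cring (mpoly_ring V :: (('v \<Rightarrow>\<^sub>0 nat) \<Rightarrow>\<^sub>0 'k::comm_ring_1) ring)"
proof (rule cringI)
  show "abelian_group (mpoly_ring V :: (('v \<Rightarrow>\<^sub>0 nat) \<Rightarrow>\<^sub>0 'k) ring)"
  proof (rule abelian_groupI)
    fix f g :: "('v \<Rightarrow>\<^sub>0 nat) \<Rightarrow>\<^sub>0 'k"
    assume "f \<in> carrier (mpoly_ring V)" "g \<in> carrier (mpoly_ring V)"
    then show "f \<oplus>\<^bsub>mpoly_ring V\<^esub> g \<in> carrier (mpoly_ring V)"
      using Poly_Mapping.keys_add[of f g] by (fastforce simp: mem_carrier_mpoly_ring)
  next
    fix f :: "('v \<Rightarrow>\<^sub>0 nat) \<Rightarrow>\<^sub>0 'k"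
    assume "f \<in> carrier (mpoly_ring V)"
    then show "\<exists>g\<in>carrier (mpoly_ring V). g \<oplus>\<^bsub>mpoly_ring V\<^esub> f = \<zero>\<^bsub>mpoly_ring V\<^esub>"
      by (intro bexI[of _ "- f"]) (auto simp: mem_carrier_mpoly_ring)
  qed (auto simp: mem_carrier_mpoly_ring ac_simps)
  show "Group.comm_monoid (mpoly_ring V :: (('v \<Rightarrow>\<^sub>0 nat) \<Rightarrow>\<^sub>0 'k) ring)"
  proof (rule comm_monoidI)
    fix f g :: "('v \<Rightarrow>\<^sub>0 nat) \<Rightarrow>\<^sub>0 'k"
    assume f: "f \<in> carrier (mpoly_ring V)" and g: "g \<in> carrier (mpoly_ring V)"
    have "Poly_Mapping.keys m \<subseteq> V" if m: "m \<in> Poly_Mapping.keys (f * g)" for m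
    proof -
      obtain a b where "m = a + b" "a \<in> Poly_Mapping.keys f" "b \<in> Poly_Mapping.keys g"
        using m Poly_Mapping.keys_mult[of f g] by blast
      then show ?thesis
        using f g Poly_Mapping.keys_add[of a b] by (fastforce simp: mem_carrier_mpoly_ring)
    qed
    then show "f \<otimes>\<^bsub>mpoly_ring V\<^esub> g \<in> carrier (mpoly_ring V)"
      by (simp add: mem_carrier_mpoly_ring)
  qed (auto simp: mem_carrier_mpoly_ring ac_simps)
qed (auto simp: algebra_simps)


section \<open>Regular sequences and depth\<close>

text \<open>The submodule \<open>(f\<^sub>1, \<dots>, f\<^sub>r)M\<close>.\<close>

definition seq_submodule :: "('r, 'm) module \<Rightarrow> 'r list \<Rightarrow> 'm set" where
  "seq_submodule M fs =
     {\<Oplus>\<^bsub>M\<^esub>j\<in>{..<length fs}. (fs ! j) \<odot>\<^bsub>M\<^esub> x j | x. x \<in> {..<length fs} \<rightarrow> carrier M}"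

text \<open>
  \<open>f\<^sub>1, \<dots>, f\<^sub>r\<close> is \<open>M\<close>-regular if each \<open>f\<^sub>i\<close> is a nonzerodivisor on
  \<open>M / (f\<^sub>1, \<dots>, f\<^sub>i\<^sub>-\<^sub>1)M\<close> and \<open>(f\<^sub>1, \<dots>, f\<^sub>r)M \<noteq> M\<close>.
\<close>

definition regular_sequence :: "('r, 'm) module \<Rightarrow> 'r list \<Rightarrow> bool" where
  "regular_sequence M fs \<longleftrightarrow>
     (\<forall>i<length fs. \<forall>x\<in>carrier M.
        (fs ! i) \<odot>\<^bsub>M\<^esub> x \<in> seq_submodule M (take i fs) \<longrightarrow> x \<in> seq_submodule M (take i fs)) \<and>
     seq_submodule M fs \<noteq> carrier M"

text \<open>
  The supremum is taken in \<^typ>\<open>enat\<close> so that no finiteness has to be presupposed; it is the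
  maximum whenever the lengths of the regular sequences in \<open>\<mm>\<close> are bounded.
\<close>

definition depth :: "'r set \<Rightarrow> ('r, 'm) module \<Rightarrow> enat" where
  "depth \<mm> M = Sup {enat (length fs) | fs. set fs \<subseteq> \<mm> \<and> regular_sequence M fs}"

text \<open>\<open>R/J\<close> as an \<open>R\<close>-module.\<close>

definition quotient_module :: "('a, 'b) ring_scheme \<Rightarrow> 'a set \<Rightarrow> ('a, 'a set) module" where
  "quotient_module R J =
     ring.extend (R Quot J) \<lparr>smult = (\<lambda>r X. (J +>\<^bsub>R\<^esub> r) \<otimes>\<^bsub>R Quot J\<^esub> X)\<rparr>"

lemma quotient_module_simps [simp]:
  "carrier (quotient_module R J) = carrier (R Quot J)"
  "monoid.mult (quotient_module R J) = monoid.mult (R Quot J)"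
  "one (quotient_module R J) = one (R Quot J)"
  "zero (quotient_module R J) = zero (R Quot J)"
  "add (quotient_module R J) = add (R Quot J)"
  "r \<odot>\<^bsub>quotient_module R J\<^esub> X = (J +>\<^bsub>R\<^esub> r) \<otimes>\<^bsub>R Quot J\<^esub> X"
  by (simp_all add: quotient_module_def ring.extend_def)

lemma module_quotient_module:
  assumes "cring R" "ideal J R"
  shows "module R (quotient_module R J)"
proof -
  interpret R: cring R by fact
  interpret J: ideal J R by fact
  interpret Q: cring "R Quot J" by (rule J.quotient_is_cring[OF assms(1)])
  interpret h: ring_hom_ring R "R Quot J" "(+>\<^bsub>R\<^esub>) J" by (rule J.rcos_ring_hom_ring)
  show ?thesis
  proof (rule moduleI)
    show "abelian_group (quotient_module R J)"
    proof (rule abelian_groupI)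
      fix X assume "X \<in> carrier (quotient_module R J)"
      then show "\<exists>Y\<in>carrier (quotient_module R J).
          Y \<oplus>\<^bsub>quotient_module R J\<^esub> X = \<zero>\<^bsub>quotient_module R J\<^esub>"
        by (intro bexI[of _ "\<ominus>\<^bsub>R Quot J\<^esub> X"]) (simp_all add: Q.l_neg)
    qed (simp_all add: Q.a_ac)
  qed (simp_all add: R.is_cring Q.l_distr Q.r_distr Q.m_assoc)
qed


section \<open>Graphs, diameter and edge ideals\<close>

text \<open>
  A finite simple graph is an element of the locale \<^locale>\<open>graph\<close>, i.e. a finite symmetric
  digraph without loops and without parallel arcs, an undirected edge \<open>{u, v}\<close> being the pair of
  arcs \<open>(u, v)\<close> and \<open>(v, u)\<close>.  As the arcs are symmetric, the strongly connected components
  \<^const>\<open>pre_digraph.sccs\<close> are the connected components, each one an induced subgraph.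
\<close>

definition path_dist :: "('v, 'e) pre_digraph \<Rightarrow> 'v \<Rightarrow> 'v \<Rightarrow> nat" where
  "path_dist H u v = (LEAST n. \<exists>p. pre_digraph.apath H u p v \<and> length p = n)"

definition connected_diameter :: "('v, 'e) pre_digraph \<Rightarrow> nat" where
  "connected_diameter H = Max {path_dist H u v | u v. u \<in> verts H \<and> v \<in> verts H}"

definition graph_diameter :: "('v, 'e) pre_digraph \<Rightarrow> nat" where
  "graph_diameter G = Max (connected_diameter ` pre_digraph.sccs G)"

definition edge_ideal :: "('v, 'e) pre_digraph \<Rightarrow> (('v \<Rightarrow>\<^sub>0 nat) \<Rightarrow>\<^sub>0 'k::comm_ring_1) set" where
  "edge_ideal G = Idl\<^bsub>mpoly_ring (verts G)\<^esub> {var u * var v | u v. u \<rightarrow>\<^bsub>G\<^esub> v}"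

end

theory Submission
  imports Defs "HOL-Library.Multiset"
begin

text \<open>
  If \<open>R/J\<close> has a filtration by monomial ideals whose factors are polynomial rings in at least \<open>s\<close>
  of the variables, then the elementary symmetric polynomials \<open>e\<^sub>1, \<dots>, e\<^sub>s\<close> in all variables form an
  \<open>R/J\<close>-regular sequence: regularity of a fixed sequence passes to extensions, and modulo the
  remaining variables one gets the elementary symmetric polynomials of a subset.

  To find such a filtration of \<open>R/I\<^sup>3\<close>, filter \<open>I\<^sup>n/I\<^sup>n\<^sup>+\<^sup>1\<close> for \<open>n \<le> 2\<close> by the products \<open>L\<close> of \<open>n\<close> edges,
  ordered by a weight on the variables.  The annihilator \<open>J\<close> of a factor agrees with \<open>I\<close> outside the neighbourhood
  of \<open>L\<close>.  Now split according to whether a variable \<open>u\<close> is killed or divided out, for all \<open>u\<close>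
  except the centres of disjoint stars.  If the neighbours of a centre are all killed, the centre
  stays free; if a neighbour is divided out, that neighbour stays free instead, unless its square
  lies in \<open>J\<close>.  For \<open>n = 2\<close> a square in \<open>J\<close> comes from a triangle on an edge of \<open>L\<close> or from a closed
  walk of length five.  Hence centres have to be avoided only near two triangles or one pentagon.
  On a shortest path realising the diameter these rule out at most eight vertices, and every third
  one of the others can be chosen as a centre, together with a vertex of each other component.
\<close>

section \<open>Monomials as multisets and monomial ideals\<close>

text \<open>All factors are tested with the same sequence \<open>esym\<close>, so no homological
  characterisation of depth enters: regularity is glued along short exact sequences. Since factors
  may vanish, \<open>regular_mod\<close> does not ask for a proper submodule; properness is checked
  once at the end. Until the last section all ideals live in the polynomial ring in every variable
  of the type, and variables outside the graph are put into the ideal, so that they behave like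
  killed ones.

  The constants come from a potential \<Phi> changing by at most one along an edge. A triangle meets
  at most two consecutive values and its neighbours at most four. A closed walk of length five and
  its neighbours stay within three of one value, so seven values suffice, and two windows of four
  cover them. Removing 8 of the d + 1 values on a diametral path and keeping a third of the rest
  gives the ceiling of (d - 7) / 3. A window that meets the value of another component misses the
  path; it then costs one centre, worth three path values, instead of four values.\<close>

definition mset_of :: "('v \<Rightarrow>\<^sub>0 nat) \<Rightarrow> 'v multiset" where
  "mset_of m = Abs_multiset (Poly_Mapping.lookup m)"

definition expo :: "'v multiset \<Rightarrow> ('v \<Rightarrow>\<^sub>0 nat)" where
  "expo M = Abs_poly_mapping (count M)"

lemma count_mset_of [simp]: "count (mset_of m) v = Poly_Mapping.lookup m v"
  unfolding mset_of_def by (subst count_Abs_multiset) simp_all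

lemma lookup_expo [simp]: "Poly_Mapping.lookup (expo M) v = count M v"
  unfolding expo_def by (subst lookup_Abs_poly_mapping) simp_all

lemma mset_of_expo [simp]: "mset_of (expo M) = M"
  by (rule multiset_eqI) simp

lemma expo_mset_of [simp]: "expo (mset_of m) = m"
  by (rule poly_mapping_eqI) simp

lemma mset_of_add [simp]: "mset_of (a + b) = mset_of a + mset_of b"
  by (rule multiset_eqI) (simp add: lookup_add)

lemma expo_add: "expo (A + B) = expo A + expo B"
  by (rule poly_mapping_eqI) (simp add: lookup_add)

lemma mset_of_zero [simp]: "mset_of 0 = {#}"
  by (rule multiset_eqI) simp

lemma expo_empty [simp]: "expo {#} = 0"
  by (rule poly_mapping_eqI) simp

lemma set_mset_of [simp]: "set_mset (mset_of m) = Poly_Mapping.keys m"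
  by (auto simp: set_mset_def in_keys_iff)

type_synonym ('v, 'k) mpoly = "('v \<Rightarrow>\<^sub>0 nat) \<Rightarrow>\<^sub>0 'k"

definition monomial :: "'v multiset \<Rightarrow> ('v, 'k::comm_ring_1) mpoly" where
  "monomial M = Poly_Mapping.single (expo M) 1"

lemma monomial_add: "monomial (A + B) = monomial A * monomial B"
  by (simp add: monomial_def expo_add mult_single)

lemma monomial_empty [simp]: "monomial {#} = 1"
  by (simp add: monomial_def)

lemma keys_monomial: "Poly_Mapping.keys (monomial M) \<subseteq> {expo M}"
  by (simp add: monomial_def)

lemma lookup_monomial_mult:
  "Poly_Mapping.lookup (monomial M * f) (expo M + k) = Poly_Mapping.lookup f k"
  by (simp add: monomial_def lookup_mult lookup_single when_mult)

lemma keys_monomial_mult: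
  "Poly_Mapping.keys (monomial M * f) = (+) (expo M) ` Poly_Mapping.keys f"
proof (intro equalityI subsetI)
  fix k assume "k \<in> Poly_Mapping.keys (monomial M * f)"
  then show "k \<in> (+) (expo M) ` Poly_Mapping.keys f"
    using keys_mult[of "monomial M" f] keys_monomial[of M] by blast
qed (auto simp: in_keys_iff lookup_monomial_mult)

section \<open>Restricting a polynomial to part of its support\<close>

definition restrict_keys :: "('a \<Rightarrow> bool) \<Rightarrow> ('a \<Rightarrow>\<^sub>0 'b::comm_monoid_add) \<Rightarrow> ('a \<Rightarrow>\<^sub>0 'b)" where
  "restrict_keys P f = Abs_poly_mapping (\<lambda>k. if P k then Poly_Mapping.lookup f k else 0)"

lemma lookup_restrict_keys:
  "Poly_Mapping.lookup (restrict_keys P f) k = (if P k then Poly_Mapping.lookup f k else 0)"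
proof -
  have "finite {k. (if P k then Poly_Mapping.lookup f k else 0) \<noteq> 0}"
    by (rule finite_subset[OF _ finite_lookup[of f]]) auto
  then show ?thesis by (simp add: restrict_keys_def lookup_Abs_poly_mapping)
qed

lemma keys_restrict_keys: "Poly_Mapping.keys (restrict_keys P f) = {k \<in> Poly_Mapping.keys f. P k}"
  by (auto simp: in_keys_iff lookup_restrict_keys split: if_splits)

lemma restrict_keys_add: "restrict_keys P (f + g) = restrict_keys P f + restrict_keys P g"
  by (rule poly_mapping_eqI) (simp add: lookup_restrict_keys lookup_add)

lemma restrict_keys_sum: "restrict_keys P (\<Sum>i\<in>A. f i) = (\<Sum>i\<in>A. restrict_keys P (f i))"
  by (rule poly_mapping_eqI) (simp add: lookup_restrict_keys lookup_sum)

lemma restrict_keys_id: "(\<And>k. k \<in> Poly_Mapping.keys f \<Longrightarrow> P k) \<Longrightarrow> restrict_keys P f = f"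
  by (rule poly_mapping_eqI) (auto simp: lookup_restrict_keys in_keys_iff)

lemma restrict_keys_0: "(\<And>k. k \<in> Poly_Mapping.keys f \<Longrightarrow> \<not> P k) \<Longrightarrow> restrict_keys P f = 0"
  by (rule poly_mapping_eqI) (auto simp: lookup_restrict_keys in_keys_iff)

lemma restrict_keys_split: "f = restrict_keys P f + restrict_keys (\<lambda>k. \<not> P k) f"
  by (rule poly_mapping_eqI) (simp add: lookup_restrict_keys lookup_add)

text \<open>Split \<open>h\<close> by \<open>Q\<close>: the exponents of \<open>g\<close> times the
  first part all satisfy \<open>P\<close>, those of \<open>g\<close> times the second part never do.
  Used for truncation by degree and for projection to fewer variables.\<close>

lemma restrict_keys_mult:
  fixes g h :: "('v, 'k::comm_ring_1) mpoly"
  assumes "\<And>a b. a \<in> Poly_Mapping.keys g \<Longrightarrow> P (a + b) \<longleftrightarrow> Q b"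
  shows "restrict_keys P (g * h) = g * restrict_keys Q h"
proof -
  have "restrict_keys P (g * h)
      = restrict_keys P (g * restrict_keys Q h + g * restrict_keys (\<lambda>k. \<not> Q k) h)"
    by (metis distrib_left restrict_keys_split)
  moreover have "restrict_keys P (g * restrict_keys Q h) = g * restrict_keys Q h"
    by (rule restrict_keys_id)
      (use assms keys_mult[of g "restrict_keys Q h"] in \<open>auto simp: keys_restrict_keys\<close>)
  moreover have "restrict_keys P (g * restrict_keys (\<lambda>k. \<not> Q k) h) = 0"
    by (rule restrict_keys_0)
      (use assms keys_mult[of g "restrict_keys (\<lambda>k. \<not> Q k) h"] in \<open>auto simp: keys_restrict_keys\<close>)
  ultimately show ?thesis by (simp add: restrict_keys_add)
qed

text \<open>The quotient is \<open>f\<close> with its exponents shifted down by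
  \<open>expo M\<close>; exponents not above \<open>M\<close> have coefficient zero on both
  sides.\<close>

lemma monomial_dvd:
  assumes "\<And>k. k \<in> Poly_Mapping.keys f \<Longrightarrow> M \<subseteq># mset_of k"
  obtains q where "f = monomial M * q"
proof
  define q where "q = Poly_Mapping.map_key ((+) (expo M)) f"
  have inj: "inj ((+) (expo M))" by (simp add: inj_def)
  have q: "Poly_Mapping.lookup q k = Poly_Mapping.lookup f (expo M + k)" for k
    by (simp add: q_def map_key.rep_eq[OF inj])
  show "f = monomial M * q"
  proof (rule poly_mapping_eqI)
    fix k
    show "Poly_Mapping.lookup f k = Poly_Mapping.lookup (monomial M * q) k"
    proof (cases "M \<subseteq># mset_of k")
      case True
      then have "k = expo M + expo (mset_of k - M)"
        by (metis expo_add expo_mset_of subset_mset.add_diff_inverse)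
      then show ?thesis using lookup_monomial_mult[of M q "expo (mset_of k - M)"] q by simp
    next
      case False
      then have "k \<notin> (+) (expo M) ` Poly_Mapping.keys q" by auto
      with False show ?thesis
        using assms by (metis in_keys_iff keys_monomial_mult)
    qed
  qed
qed

section \<open>Upward closed sets of monomials and the ideals they span\<close>

definition upset :: "'v multiset set \<Rightarrow> bool" where
  "upset N \<longleftrightarrow> (\<forall>M\<in>N. \<forall>M'. M + M' \<in> N)"

definition multiples :: "'v multiset set \<Rightarrow> 'v multiset set" where
  "multiples S = {M. \<exists>L\<in>S. L \<subseteq># M}"

definition colon :: "'v multiset set \<Rightarrow> 'v multiset \<Rightarrow> 'v multiset set" where
  "colon N L = {M. L + M \<in> N}"

lemma upsetD: "upset N \<Longrightarrow> M \<in> N \<Longrightarrow> M \<subseteq># M' \<Longrightarrow> M' \<in> N"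
  unfolding upset_def by (metis subset_mset.add_diff_inverse)

lemma upset_colon: "upset N \<Longrightarrow> upset (colon N L)"
  by (simp add: upset_def colon_def flip: add.assoc)

lemma upset_multiples: "upset (multiples S)"
  by (auto simp: upset_def multiples_def intro: subset_mset.order_trans mset_subset_eq_add_left)

lemma upset_Un: "upset N \<Longrightarrow> upset N' \<Longrightarrow> upset (N \<union> N')"
  by (auto simp: upset_def)

lemma multiples_insert: "multiples (insert L S) = multiples {L} \<union> multiples S"
  by (auto simp: multiples_def)

definition mideal :: "'v multiset set \<Rightarrow> ('v, 'k::comm_ring_1) mpoly set" where
  "mideal N = {f. \<forall>m\<in>Poly_Mapping.keys f. mset_of m \<in> N}"

lemma mideal_0 [simp]: "0 \<in> mideal N"
  by (simp add: mideal_def)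

lemma mideal_add: "f \<in> mideal N \<Longrightarrow> g \<in> mideal N \<Longrightarrow> f + g \<in> mideal N"
  using keys_add[of f g] by (auto simp: mideal_def)

lemma mideal_uminus: "f \<in> mideal N \<Longrightarrow> - f \<in> mideal N"
  by (simp add: mideal_def)

lemma mideal_diff: "f \<in> mideal N \<Longrightarrow> g \<in> mideal N \<Longrightarrow> f - g \<in> mideal N"
  using mideal_add[of f N "- g"] mideal_uminus[of g N] by simp

lemma mideal_mult:
  assumes "upset N" "f \<in> mideal N"
  shows "g * f \<in> mideal N" "f * g \<in> mideal N"
proof -
  show "f * g \<in> mideal N"
    using assms keys_mult[of f g] unfolding mideal_def upset_def by fastforce
  then show "g * f \<in> mideal N" by (simp add: mult.commute)
qed

lemma mideal_sum: "(\<And>i. i \<in> A \<Longrightarrow> f i \<in> mideal N) \<Longrightarrow> (\<Sum>i\<in>A. f i) \<in> mideal N"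
  by (induction A rule: infinite_finite_induct) (auto intro: mideal_add)

lemma monomial_in_mideal: "M \<in> N \<Longrightarrow> monomial M \<in> mideal N"
  using keys_monomial[of M] by (auto simp: mideal_def)

lemma restrict_keys_mideal: "f \<in> mideal N \<Longrightarrow> restrict_keys P f \<in> mideal N"
  by (auto simp: mideal_def keys_restrict_keys)

lemma monomial_mult_mideal_iff: "monomial L * f \<in> mideal N \<longleftrightarrow> f \<in> mideal (colon N L)"
  by (auto simp: mideal_def keys_monomial_mult colon_def)

lemma mideal_mono: "N \<subseteq> N' \<Longrightarrow> mideal N \<subseteq> mideal N'"
  by (auto simp: mideal_def)

text \<open>Sort the monomials of \<open>f\<close> by membership in \<open>N\<close>: those outside
  \<open>N\<close> are all divisible by \<open>L\<close>, and so is their sum.\<close>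

lemma mideal_Un_multiples:
  assumes "f \<in> mideal (N \<union> multiples {L})"
  obtains g q where "g \<in> mideal N" "f = g + monomial L * q"
proof -
  let ?P = "\<lambda>k. mset_of k \<in> N"
  have "L \<subseteq># mset_of k" if "k \<in> Poly_Mapping.keys (restrict_keys (\<lambda>k. \<not> ?P k) f)" for k
    using assms that by (auto simp: keys_restrict_keys mideal_def multiples_def)
  then obtain q where "restrict_keys (\<lambda>k. \<not> ?P k) f = monomial L * q"
    by (rule monomial_dvd)
  moreover have "restrict_keys ?P f \<in> mideal N"
    by (auto simp: mideal_def keys_restrict_keys)
  ultimately show ?thesis using that[of "restrict_keys ?P f" q] restrict_keys_split[of f ?P] by simp
qed

lemma multiples_monomial_in_mideal: "monomial L * q \<in> mideal (N \<union> multiples {L})"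
  by (auto simp: mideal_def keys_monomial_mult multiples_def)


section \<open>Regular sequences modulo monomial ideals\<close>

definition ideal_ext :: "(nat \<Rightarrow> ('v, 'k::comm_ring_1) mpoly) \<Rightarrow> 'v multiset set \<Rightarrow> nat
    \<Rightarrow> ('v, 'k) mpoly set" where
  "ideal_ext g N i = {f + (\<Sum>l<i. g l * h l) | f h. f \<in> mideal N}"

text \<open>Regularity on the quotient by \<open>mideal N\<close> in the weak sense, which also
  holds on the zero module.\<close>

definition regular_mod :: "(nat \<Rightarrow> ('v, 'k::comm_ring_1) mpoly) \<Rightarrow> nat \<Rightarrow> 'v multiset set \<Rightarrow> bool" where
  "regular_mod g s N \<longleftrightarrow> (\<forall>i<s. \<forall>f. g i * f \<in> ideal_ext g N i \<longrightarrow> f \<in> ideal_ext g N i)"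

lemma ideal_extI: "f \<in> mideal N \<Longrightarrow> f + (\<Sum>l<i. g l * h l) \<in> ideal_ext g N i"
  by (auto simp: ideal_ext_def)

lemma mideal_subset_ideal_ext: "mideal N \<subseteq> ideal_ext g N i"
  using ideal_extI[of _ N g "\<lambda>_. 0" i] by auto

lemma ideal_ext_add: "a \<in> ideal_ext g N i \<Longrightarrow> b \<in> ideal_ext g N i \<Longrightarrow> a + b \<in> ideal_ext g N i"
proof -
  assume "a \<in> ideal_ext g N i" "b \<in> ideal_ext g N i"
  then obtain f h f' h' where "f \<in> mideal N" "f' \<in> mideal N"
    "a = f + (\<Sum>l<i. g l * h l)" "b = f' + (\<Sum>l<i. g l * h' l)"
    unfolding ideal_ext_def by blast
  then have "f + f' \<in> mideal N" "a + b = (f + f') + (\<Sum>l<i. g l * (h l + h' l))"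
    by (simp_all add: mideal_add sum.distrib distrib_left)
  then show ?thesis using ideal_extI[of "f + f'" N g "\<lambda>l. h l + h' l" i] by simp
qed

lemma ideal_ext_mult:
  assumes "upset N" "a \<in> ideal_ext g N i"
  shows "c * a \<in> ideal_ext g N i"
proof -
  obtain f h where "f \<in> mideal N" "a = f + (\<Sum>l<i. g l * h l)"
    using assms unfolding ideal_ext_def by blast
  then have "c * f \<in> mideal N" "c * a = c * f + (\<Sum>l<i. g l * (c * h l))"
    using assms by (simp_all add: mideal_mult distrib_left sum_distrib_left mult.left_commute)
  then show ?thesis using ideal_extI[of "c * f" N g "\<lambda>l. c * h l" i] by simp
qed

lemma ideal_ext_uminus: "upset N \<Longrightarrow> a \<in> ideal_ext g N i \<Longrightarrow> - a \<in> ideal_ext g N i"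
  using ideal_ext_mult[of N a g i "- 1"] by simp

lemma ideal_ext_diff: "upset N \<Longrightarrow> a \<in> ideal_ext g N i \<Longrightarrow> b \<in> ideal_ext g N i \<Longrightarrow> a - b \<in> ideal_ext g N i"
  using ideal_ext_add[of a g N i "- b"] ideal_ext_uminus[of N b g i] by simp

lemma ideal_ext_mono: "N \<subseteq> N' \<Longrightarrow> ideal_ext g N i \<subseteq> ideal_ext g N' i"
  unfolding ideal_ext_def using mideal_mono by blast

text \<open>This is the vanishing of the first Tor in elementary form: for a sequence regular modulo
  N, an element of N that is a combination of the \<open>g l\<close> is such a combination with
  coefficients in N.\<close>

lemma regular_mod_inter:
  assumes "upset N" "regular_mod g s N" "i \<le> s" "(\<Sum>l<i. g l * h l) \<in> mideal N"
  shows "\<exists>k. (\<forall>l. k l \<in> mideal N) \<and> (\<Sum>l<i. g l * h l) = (\<Sum>l<i. g l * k l)"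
  using assms(3,4)
proof (induction i arbitrary: h)
  case 0
  show ?case by (rule exI[of _ "\<lambda>_. 0"]) simp
next
  case (Suc i)
  have "g i * h i = (\<Sum>l<Suc i. g l * h l) + (\<Sum>l<i. g l * (- h l))"
    by (simp add: sum_negf)
  also have "\<dots> \<in> ideal_ext g N i" by (rule ideal_extI[OF Suc.prems(2)])
  finally have "g i * h i \<in> ideal_ext g N i" .
  then have "h i \<in> ideal_ext g N i" using assms(2) Suc.prems(1) by (auto simp: regular_mod_def)
  then obtain c d where c: "c \<in> mideal N" and hi: "h i = c + (\<Sum>l<i. g l * d l)"
    unfolding ideal_ext_def by blast
  \<comment> \<open>The part of \<open>h i\<close> generated by the earlier \<open>g l\<close> is
    moved into their coefficients, which leaves \<open>c\<close> as the coefficient of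
    \<open>g i\<close>.\<close>
  have eq: "(\<Sum>l<Suc i. g l * h l) = g i * c + (\<Sum>l<i. g l * (h l + g i * d l))"
    by (simp add: hi distrib_left sum.distrib sum_distrib_left mult.left_commute add_ac)
  then have "(\<Sum>l<i. g l * (h l + g i * d l)) \<in> mideal N"
    using mideal_diff[OF Suc.prems(2) mideal_mult(1)[OF assms(1) c, of "g i"]] by simp
  then obtain k where k: "\<forall>l. k l \<in> mideal N"
    "(\<Sum>l<i. g l * (h l + g i * d l)) = (\<Sum>l<i. g l * k l)"
    using Suc.IH[of "\<lambda>l. h l + g i * d l"] Suc.prems(1) by auto
  have "\<forall>l. (k(i := c)) l \<in> mideal N" using k c by simp
  moreover have "(\<Sum>l<Suc i. g l * h l) = (\<Sum>l<Suc i. g l * (k(i := c)) l)"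
    unfolding eq k(2) by simp
  ultimately show ?case by blast
qed

lemma ideal_ext_colon_lift:
  assumes "upset N" "q \<in> ideal_ext g (colon N L) i"
  shows "monomial L * q \<in> ideal_ext g N i"
proof -
  obtain f h where "f \<in> mideal (colon N L)" "q = f + (\<Sum>l<i. g l * h l)"
    using assms unfolding ideal_ext_def by blast
  then have "monomial L * f \<in> mideal N"
    "monomial L * q = monomial L * f + (\<Sum>l<i. g l * (monomial L * h l))"
    by (simp_all add: monomial_mult_mideal_iff distrib_left sum_distrib_left mult.left_commute)
  then show ?thesis using ideal_extI[of "monomial L * f" N g "\<lambda>l. monomial L * h l" i] by simp
qed

text \<open>By \<open>regular_mod_inter\<close> the coefficients of the \<open>g l\<close> can be
  taken in N + (L), and their parts divisible by L are absorbed into the multiple of L. Hence the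
  embedding of R/(N : L) into R/N by L stays injective modulo the first i elements.\<close>

lemma ideal_ext_colon_drop:
  assumes "upset N" "regular_mod g s (N \<union> multiples {L})" "i \<le> s"
    and "monomial L * q \<in> ideal_ext g N i"
  shows "q \<in> ideal_ext g (colon N L) i"
proof -
  let ?N = "N \<union> multiples {L}"
  have up: "upset ?N" using assms(1) by (simp add: upset_Un upset_multiples)
  obtain f h where f: "f \<in> mideal N" and eq: "monomial L * q = f + (\<Sum>l<i. g l * h l)"
    using assms(4) unfolding ideal_ext_def by blast
  have "(\<Sum>l<i. g l * h l) = monomial L * q - f" using eq by simp
  then have "(\<Sum>l<i. g l * h l) \<in> mideal ?N"
    using f mideal_mono[of N ?N] by (auto intro!: mideal_diff multiples_monomial_in_mideal)
  then obtain k where k: "\<And>l. k l \<in> mideal ?N" and keq: "(\<Sum>l<i. g l * h l) = (\<Sum>l<i. g l * k l)"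
    using regular_mod_inter[OF up assms(2,3)] by blast
  have "\<exists>a b. a \<in> mideal N \<and> k l = a + monomial L * b" for l
    using k[of l] by (rule mideal_Un_multiples) blast
  then obtain a b where ab: "\<And>l. a l \<in> mideal N" "\<And>l. k l = a l + monomial L * b l" by metis
  have "monomial L * (q - (\<Sum>l<i. g l * b l)) = f + (\<Sum>l<i. g l * a l)"
    unfolding right_diff_distrib eq keq ab(2)
    by (simp add: distrib_left sum.distrib sum_distrib_left mult.left_commute)
  also have "\<dots> \<in> mideal N"
    using f ab(1) assms(1) by (intro mideal_add mideal_sum mideal_mult) auto
  finally have "q - (\<Sum>l<i. g l * b l) \<in> mideal (colon N L)"
    by (simp add: monomial_mult_mideal_iff)
  from ideal_extI[OF this, of g b i] show ?thesis by simp
qed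

lemma ideal_ext_Un_multiples:
  assumes "f \<in> ideal_ext g (N \<union> multiples {L}) i"
  obtains a q where "a \<in> ideal_ext g N i" "f = a + monomial L * q"
proof -
  obtain b h where b: "b \<in> mideal (N \<union> multiples {L})" and f: "f = b + (\<Sum>l<i. g l * h l)"
    using assms unfolding ideal_ext_def by blast
  obtain c q where "c \<in> mideal N" "b = c + monomial L * q"
    using b by (rule mideal_Un_multiples)
  then show ?thesis using that[of "c + (\<Sum>l<i. g l * h l)" q] ideal_extI[of c N g h i] f
    by (simp add: add_ac)
qed

text \<open>R/N is an extension of R/(N + (L)) by R/(N : L). Regularity on the quotient reduces f to
  a multiple of L, and regularity on the colon takes care of the cofactor.\<close>

lemma regular_mod_split:
  assumes "upset N" "regular_mod g s (colon N L)" "regular_mod g s (N \<union> multiples {L})"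
  shows "regular_mod g s N"
  unfolding regular_mod_def
proof (intro allI impI)
  fix i f assume i: "i < s" and gf: "g i * f \<in> ideal_ext g N i"
  let ?N = "N \<union> multiples {L}"
  have "g i * f \<in> ideal_ext g ?N i" using gf ideal_ext_mono[of N ?N] by blast
  then have "f \<in> ideal_ext g ?N i" using assms(3) i by (simp add: regular_mod_def)
  then obtain a q where a: "a \<in> ideal_ext g N i" and f: "f = a + monomial L * q"
    by (rule ideal_ext_Un_multiples)
  have "monomial L * (g i * q) = g i * f - g i * a" by (simp add: f algebra_simps)
  also have "\<dots> \<in> ideal_ext g N i"
    using ideal_ext_diff[OF assms(1) gf] ideal_ext_mult[OF assms(1) a] by blast
  finally have "g i * q \<in> ideal_ext g (colon N L) i"
    by (rule ideal_ext_colon_drop[OF assms(1,3) less_imp_le[OF i]])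
  then have "q \<in> ideal_ext g (colon N L) i" using assms(2) i by (simp add: regular_mod_def)
  then show "f \<in> ideal_ext g N i"
    unfolding f by (intro ideal_ext_add a ideal_ext_colon_lift assms(1))
qed

lemma regular_mod_empty_mset:
  assumes "upset N" "{#} \<in> N"
  shows "regular_mod g s N"
proof -
  have "f \<in> ideal_ext g N i" for f i
    using mideal_subset_ideal_ext[of N g i] upsetD[OF assms] by (auto simp: mideal_def)
  then show ?thesis by (simp add: regular_mod_def)
qed

text \<open>The weight prescribes the order in which the monomials are adjoined, up to ties.\<close>

lemma regular_mod_filtration:
  fixes w :: "'v multiset \<Rightarrow> nat"
  assumes "finite S" "upset N" "regular_mod g s (N \<union> multiples S)"
    and "\<And>L T. L \<in> S \<Longrightarrow> T \<subseteq> S - {L} \<Longrightarrow> {M \<in> S. w M < w L} \<subseteq> T \<Longrightarrow> (\<forall>M\<in>T. w M \<le> w L)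
      \<Longrightarrow> regular_mod g s (colon (N \<union> multiples T) L)"
  shows "regular_mod g s N"
  using assms(1,3,4)
proof (induction S rule: finite_psubset_induct)
  case (psubset S)
  note split = psubset.prems(2)
  show ?case
  proof (cases "S = {}")
    case True
    then have "multiples S = {}" by (simp add: multiples_def)
    then show ?thesis using psubset.prems(1) by simp
  next
    case False
    have fw: "finite (w ` S)" using psubset.hyps by simp
    \<comment> \<open>The heaviest product is split off, so that everything lighter lies in the set
      adjoined before it.\<close>
    obtain L where L: "L \<in> S" "w L = Max (w ` S)"
      using Max_in[OF fw] False by fastforce
    then have maxL: "w M \<le> w L" if "M \<in> S" for M using fw that by simp
    let ?T = "S - {L}"
    have "insert L ?T = S" using L by blast
    then have ins: "N \<union> multiples S = (N \<union> multiples ?T) \<union> multiples {L}"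
      using multiples_insert[of L ?T] by auto
    have reg: "regular_mod g s (N \<union> multiples ?T)"
    proof (rule regular_mod_split)
      show "upset (N \<union> multiples ?T)" using assms(2) by (simp add: upset_Un upset_multiples)
      show "regular_mod g s (colon (N \<union> multiples ?T) L)"
      proof (rule split)
        show "{M \<in> S. w M < w L} \<subseteq> ?T" by auto
      qed (use L(1) maxL in auto)
      show "regular_mod g s (N \<union> multiples ?T \<union> multiples {L})" using psubset.prems(1) ins by simp
    qed
    have sub: "?T \<subset> S" using L(1) by blast
    show ?thesis
    proof (rule psubset.IH[OF sub reg])
      fix M T
      assume M: "M \<in> ?T" "T \<subseteq> ?T - {M}" "{K \<in> ?T. w K < w M} \<subseteq> T" "\<forall>K\<in>T. w K \<le> w M"
      \<comment> \<open>\<open>L\<close> is at least as heavy as \<open>M\<close>, so returning it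
        to the set adds nothing to the lighter products.\<close>
      have "\<not> w L < w M" using maxL M(1) by (simp add: linorder_not_less)
      then have "{K \<in> S. w K < w M} \<subseteq> T" using M(3) by auto
      then show "regular_mod g s (colon (N \<union> multiples T) M)" using M by (intro split) auto
    qed
  qed
qed

section \<open>Elementary symmetric polynomials modulo variables\<close>

definition esym :: "'v set \<Rightarrow> nat \<Rightarrow> ('v, 'k::comm_ring_1) mpoly" where
  "esym V i = (\<Sum>A | A \<subseteq> V \<and> card A = i. monomial (mset_set A))"

text \<open>
  \<open>mideal (nonface F)\<close> is the ideal generated by the variables outside \<open>F\<close>, in the polynomial
  ring in all variables of type \<^typ>\<open>'v\<close>.
\<close>

definition nonface :: "'v set \<Rightarrow> 'v multiset set" where
  "nonface F = {M. \<not> set_mset M \<subseteq> F}"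

lemma upset_nonface: "upset (nonface F)"
  by (auto simp: upset_def nonface_def)

lemma nonface_remove: "nonface F \<union> multiples {{#x#}} = nonface (F - {x})"
  by (auto simp: nonface_def multiples_def)

lemma colon_nonface: "set_mset M \<subseteq> F \<Longrightarrow> colon (nonface F) M = nonface F"
  by (auto simp: nonface_def colon_def)

lemma keys_esym:
  assumes "finite V" "m \<in> Poly_Mapping.keys (esym V i :: ('v, 'k::comm_ring_1) mpoly)"
  obtains A where "A \<subseteq> V" "card A = i" "mset_of m = mset_set A"
proof -
  obtain A where A: "A \<subseteq> V" "card A = i" "m \<in> Poly_Mapping.keys (monomial (mset_set A) :: ('v, 'k) mpoly)"
    using subsetD[OF keys_sum assms(2)[unfolded esym_def]] by blast
  then have "m = expo (mset_set A)" using keys_monomial by blast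
  then show ?thesis using that[OF A(1,2)] by simp
qed

lemma size_keys_esym:
  assumes "finite V" "m \<in> Poly_Mapping.keys (esym V i)"
  shows "size (mset_of m) = i"
  by (rule keys_esym[OF assms]) simp

lemma monomial_add_mset: "monomial (add_mset x M) = monomial {#x#} * monomial M"
  using monomial_add[of "{#x#}" M] by simp

text \<open>The ideal is homogeneous: \<open>esym V (Suc l)\<close> has degree l + 1 and
  \<open>mideal N\<close> is spanned by monomials. If D \<le> l + 1, the truncated subtraction gives
  the bound 0, which is right because the whole product is then cut off.\<close>

lemma restrict_keys_ideal_ext:
  assumes "finite V" "a \<in> ideal_ext (\<lambda>i. esym V (Suc i)) N i"
  shows "restrict_keys (\<lambda>m. size (mset_of m) < D) a \<in> ideal_ext (\<lambda>i. esym V (Suc i)) N i"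
proof -
  let ?r = "\<lambda>D. restrict_keys (\<lambda>m. size (mset_of m) < D)"
  obtain f h where f: "f \<in> mideal N" and a: "a = f + (\<Sum>l<i. esym V (Suc l) * h l)"
    using assms(2) unfolding ideal_ext_def by blast
  have "?r D (esym V (Suc l) * h l) = esym V (Suc l) * ?r (D - Suc l) (h l)" for l
    by (rule restrict_keys_mult) (auto dest: size_keys_esym[OF assms(1)])
  then have "?r D a = ?r D f + (\<Sum>l<i. esym V (Suc l) * ?r (D - Suc l) (h l))"
    by (simp add: a restrict_keys_add restrict_keys_sum)
  then show ?thesis by (simp only: ideal_extI[OF restrict_keys_mideal[OF f]])
qed

text \<open>A set of the same size as F and different from F is not contained in F, so among the
  squarefree monomials of this degree only the product over F survives.\<close>

lemma esym_minus_monomial: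
  assumes "finite V" "F \<subseteq> V"
  shows "esym V (card F) - monomial (mset_set F) \<in> mideal (nonface F)"
proof -
  let ?S = "{A. A \<subseteq> V \<and> card A = card F}"
  have fin: "finite F" using assms finite_subset by blast
  have "esym V (card F) - monomial (mset_set F) = (\<Sum>A\<in>?S - {F}. monomial (mset_set A))"
    unfolding esym_def using assms by (subst sum.remove[of ?S F]) auto
  also have "\<dots> \<in> mideal (nonface F)"
  proof (rule mideal_sum, rule monomial_in_mideal)
    fix A assume A: "A \<in> ?S - {F}"
    then have "finite A" using assms finite_subset by blast
    moreover have "\<not> A \<subseteq> F" using A fin card_subset_eq by blast
    ultimately show "mset_set A \<in> nonface F" by (simp add: nonface_def)
  qed
  finally show ?thesis .
qed

text \<open>
  For \<open>x \<in> F\<close> the sequence is regular modulo the smaller face \<open>F - {x}\<close>, which makes \<open>x\<close> a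
  nonzerodivisor on the earlier quotients.  For the last element, the product of the variables
  in \<open>F\<close>, this suffices; for the others one divides by \<open>x\<close> repeatedly and compares degrees.
\<close>

lemma regular_mod_nonface:
  assumes "finite V" "F \<subseteq> V"
  shows "regular_mod (\<lambda>i. esym V (Suc i) :: ('v, 'k::comm_ring_1) mpoly) (card F) (nonface F)"
proof -
  have "finite F" using assms finite_subset by blast
  then show ?thesis using assms(2)
  proof (induction F rule: finite_psubset_induct)
    case (psubset F)
    let ?g = "\<lambda>i. esym V (Suc i) :: ('v, 'k) mpoly"
    let ?E = "ideal_ext ?g (nonface F)"
    have reg: "regular_mod ?g (card F - 1) (nonface F \<union> multiples {{#x#}})" if "x \<in> F" for x
    proof -
      have "F - {x} \<subset> F" "card (F - {x}) = card F - 1"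
        using that psubset.hyps by auto
      then show ?thesis unfolding nonface_remove using psubset.IH[of "F - {x}"] psubset.prems by auto
    qed
    have cancel: "q \<in> ?E i" if "x \<in> F" "i \<le> card F - 1" "monomial {#x#} * q \<in> ?E i" for x i q
    proof -
      have "q \<in> ideal_ext ?g (colon (nonface F) {#x#}) i"
        by (rule ideal_ext_colon_drop[OF upset_nonface reg[OF that(1)] that(2,3)])
      then show ?thesis using that(1) by (simp add: colon_nonface)
    qed
    have cancel_mon: "set_mset M \<subseteq> F \<Longrightarrow> monomial M * q \<in> ?E i \<Longrightarrow> q \<in> ?E i"
      if "i \<le> card F - 1" for M i q
    proof (induction M)
      case (add x M)
      have "monomial {#x#} * (monomial M * q) = monomial (add_mset x M) * q"
        by (simp only: monomial_add_mset[of x M] mult.assoc)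
      then have "monomial M * q \<in> ?E i" using cancel[of x i "monomial M * q"] that add.prems by simp
      then show ?case using add by simp
    qed simp
    show ?case
      unfolding regular_mod_def
    proof (intro allI impI)
      fix i f assume i: "i < card F" and gf: "?g i * f \<in> ?E i"
      show "f \<in> ?E i"
      proof (cases "Suc i = card F")
        case True
        have "(?g i - monomial (mset_set F)) * f \<in> ?E i"
          unfolding True using esym_minus_monomial[OF assms(1) psubset.prems]
            mideal_mult(2)[OF upset_nonface] mideal_subset_ideal_ext by blast
        from ideal_ext_diff[OF upset_nonface gf this]
        have "monomial (mset_set F) * f \<in> ?E i" by (simp add: algebra_simps)
        then show ?thesis using cancel_mon[of i "mset_set F" f] i psubset.hyps by simp
      next
        case False
        obtain x where x: "x \<in> F" using i by fastforce
        \<comment> \<open>Regularity modulo \<open>F - {x}\<close> makes f a multiple of x up to an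
          element of the ideal, and the cofactor satisfies the same hypothesis as f. So every power
          of x can be extracted.\<close>
        have div: "\<exists>a q. a \<in> ?E i \<and> f = a + monomial (replicate_mset D x) * q"
          if "?g i * f \<in> ?E i" for D f
          using that
        proof (induction D arbitrary: f)
          case 0
          have "0 \<in> ?E i" using mideal_subset_ideal_ext mideal_0 by blast
          then show ?case by (intro exI[of _ 0] exI[of _ f]) simp
        next
          case (Suc D)
          have "?g i * f \<in> ideal_ext ?g (nonface F \<union> multiples {{#x#}}) i"
            using Suc.prems ideal_ext_mono[of "nonface F" "nonface F \<union> multiples {{#x#}}"] by blast
          moreover have "i < card F - 1" using i False by simp
          ultimately have "f \<in> ideal_ext ?g (nonface F \<union> multiples {{#x#}}) i"
            using reg[OF x] unfolding regular_mod_def by blast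
          then obtain a q where a: "a \<in> ?E i" and f: "f = a + monomial {#x#} * q"
            by (rule ideal_ext_Un_multiples)
          have "monomial {#x#} * (?g i * q) = ?g i * f - ?g i * a"
            by (simp add: f algebra_simps)
          also have "\<dots> \<in> ?E i"
            by (intro ideal_ext_diff ideal_ext_mult upset_nonface Suc.prems a)
          finally have "?g i * q \<in> ?E i" using cancel[OF x] i by simp
          from Suc.IH[OF this] obtain b r where
            b: "b \<in> ?E i" and q: "q = b + monomial (replicate_mset D x) * r" by blast
          have "f = (a + monomial {#x#} * b) + monomial (replicate_mset (Suc D) x) * r"
            by (simp add: f q monomial_add_mset[of x "replicate_mset D x"] distrib_left mult.assoc)
          moreover have "a + monomial {#x#} * b \<in> ?E i"
            by (intro ideal_ext_add ideal_ext_mult upset_nonface a b)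
          ultimately show ?case by blast
        qed
        \<comment> \<open>D exceeds the degree of every monomial of f; the inserted 0 covers f =
          0.\<close>
        define D where "D = Suc (Max (insert 0 ((\<lambda>m. size (mset_of m)) ` Poly_Mapping.keys f)))"
        have D: "size (mset_of m) < D" if "m \<in> Poly_Mapping.keys f" for m
          unfolding D_def less_Suc_eq_le by (rule Max_ge) (use that in auto)
        obtain a q where a: "a \<in> ?E i" and f: "f = a + monomial (replicate_mset D x) * q"
          using div[OF gf, of D] by blast
        let ?r = "restrict_keys (\<lambda>m. size (mset_of m) < D)"
        \<comment> \<open>Multiples of the D-th power of x have no terms of degree below D, so
          truncation leaves f equal to the truncation of \<open>a\<close>.\<close>
        have "?r (monomial (replicate_mset D x) * q) = 0"
          by (rule restrict_keys_0) (auto simp: keys_monomial_mult)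
        moreover have "?r f = f" by (rule restrict_keys_id) (rule D)
        ultimately have "?r a = f" using restrict_keys_add[of _ a] f by simp
        then show ?thesis using restrict_keys_ideal_ext[OF assms(1) a, of D] by simp
      qed
    qed
  qed
qed

lemma regular_mod_mono: "regular_mod g s N \<Longrightarrow> t \<le> s \<Longrightarrow> regular_mod g t N"
  by (simp add: regular_mod_def)

section \<open>Pieces with a star packing\<close>

lemma nonface_Un: "nonface F \<union> nonface F' = nonface (F \<inter> F')"
  by (auto simp: nonface_def)

lemma colon_Un: "colon (N \<union> N') L = colon N L \<union> colon N' L"
  by (auto simp: colon_def)

lemma colon_colon: "colon (colon N L) L' = colon N (L + L')"
  by (auto simp: colon_def add_ac)

text \<open>Each variable of T is split once: those in S are divided out, those in T - S are killed,
  since \<open>nonface (- (T - S))\<close> is generated by T - S. A choice with the product over S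
  in J leaves the zero module and imposes no condition.\<close>

lemma regular_mod_branch:
  assumes "finite T" "upset J"
    and "\<And>S. S \<subseteq> T \<Longrightarrow> mset_set S \<notin> J \<Longrightarrow>
      regular_mod g s (colon J (mset_set S) \<union> nonface (- (T - S)))"
  shows "regular_mod g s J"
  using assms(1,3)
proof (induction T)
  case empty
  have "J \<union> nonface UNIV = J" "colon J {#} = J" by (auto simp: nonface_def colon_def)
  then show ?case
    using empty[of "{}"] regular_mod_empty_mset[OF assms(2)] by (cases "{#} \<in> J") simp_all
next
  case (insert u T)
  show ?case
  proof (rule insert.IH)
    fix S assume S: "S \<subseteq> T" "mset_set S \<notin> J"
    let ?N = "colon J (mset_set S) \<union> nonface (- (T - S))"
    have fin: "finite S" "u \<notin> S" using S insert.hyps finite_subset by auto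
    show "regular_mod g s ?N"
    proof (rule regular_mod_split)
      show "upset ?N" by (simp add: upset_Un upset_colon upset_nonface assms(2))
      have eq: "insert u T - insert u S = T - S" using insert.hyps by auto
      have "colon ?N {#u#} = colon J (mset_set (insert u S)) \<union> nonface (- (insert u T - insert u S))"
        unfolding eq using insert.hyps fin by (simp add: colon_Un colon_colon colon_nonface)
      moreover have "regular_mod g s \<dots>"
      proof (cases "mset_set (insert u S) \<in> J")
        case True
        then show ?thesis
          by (intro regular_mod_empty_mset upset_Un upset_colon upset_nonface assms(2))
            (auto simp: colon_def)
      next
        case False
        then show ?thesis using insert.prems S by blast
      qed
      ultimately show "regular_mod g s (colon ?N {#u#})" by simp
      have "- (T - S) - {u} = - (insert u T - S)" using fin by auto
      then have "?N \<union> multiples {{#u#}} = colon J (mset_set S) \<union> nonface (- (insert u T - S))"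
        by (simp only: Un_assoc nonface_remove)
      then show "regular_mod g s (?N \<union> multiples {{#u#}})"
        using insert.prems[of S] S by (simp add: subset_insertI2)
    qed
  qed
qed

text \<open>One copy of a repeated variable can be removed without leaving J as long as its square
  is outside J; removal preserves the hypotheses and the support, and lowers the degree.\<close>

lemma squarefree_part_mem:
  assumes "\<And>u M. M + {#u, u#} \<in> J \<Longrightarrow> {#u, u#} \<in> J \<or> M + {#u#} \<in> J"
    and "M \<in> J" "\<And>u. {#u, u#} \<subseteq># M \<Longrightarrow> {#u, u#} \<notin> J"
  shows "mset_set (set_mset M) \<in> J"
  using assms(2,3)
proof (induction "size M" arbitrary: M rule: less_induct)
  case less
  show ?case
  proof (cases "\<exists>u. {#u, u#} \<subseteq># M")
    case True
    then obtain u where u: "{#u, u#} \<subseteq># M" by blast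
    define Q where "Q = M - {#u, u#}"
    have M: "M = Q + {#u, u#}" unfolding Q_def by (rule subset_mset.diff_add[OF u, symmetric])
    have "Q + {#u#} \<in> J" using assms(1)[of Q u] less.prems(1) less.prems(2)[OF u] M by blast
    moreover have "{#v, v#} \<notin> J" if "{#v, v#} \<subseteq># Q + {#u#}" for v
      using less.prems(2)[of v] subset_mset.order_trans[OF that, of M] M by simp
    ultimately have "mset_set (set_mset (Q + {#u#})) \<in> J" using less.hyps[of "Q + {#u#}"] M by simp
    then show ?thesis by (simp add: M)
  next
    case False
    have "mset_set (set_mset M) = M"
    proof (rule multiset_eqI)
      fix v
      have "count M v < 2"
      proof (rule ccontr)
        assume "\<not> count M v < 2"
        then have "{#v, v#} \<subseteq># M" by (auto simp: subseteq_mset_def)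
        with False show False by blast
      qed
      then show "count (mset_set (set_mset M)) v = count M v"
        using count_eq_zero_iff[of M v] by (auto simp: count_mset_set' less_2_cases_iff)
    qed
    then show ?thesis using less.prems by simp
  qed
qed

lemma pair_subset_mset: "u \<noteq> v \<Longrightarrow> {#u, v#} \<subseteq># M \<longleftrightarrow> u \<in># M \<and> v \<in># M"
  by (auto simp: insert_subset_eq_iff in_diff_count)

locale simple_graph =
  fixes V :: "'v set" and E :: "'v \<Rightarrow> 'v \<Rightarrow> bool"
  assumes finite_V: "finite V"
    and E_sym: "E u v \<Longrightarrow> E v u"
    and E_irrefl: "\<not> E u u"
    and E_V: "E u v \<Longrightarrow> u \<in> V"
begin

fun products :: "nat \<Rightarrow> 'v multiset set" where
  "products 0 = {{#}}"
| "products (Suc n) = {{#u, v#} + M | u v M. E u v \<and> M \<in> products n}"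

text \<open>The \<open>n\<close>-th power of the edge ideal, enlarged by the variables that are not vertices.\<close>

definition power_set :: "nat \<Rightarrow> 'v multiset set" where
  "power_set n = nonface V \<union> multiples (products n)"

lemma upset_power_set: "upset (power_set n)"
  by (simp add: power_set_def upset_Un upset_nonface upset_multiples)

lemma power_set_1:
  "M \<in> power_set (Suc 0) \<longleftrightarrow> \<not> set_mset M \<subseteq> V \<or> (\<exists>u v. E u v \<and> {#u, v#} \<subseteq># M)"
  by (auto simp: power_set_def multiples_def nonface_def)

lemma power_set_1_iff:
  "M \<in> power_set (Suc 0) \<longleftrightarrow> \<not> set_mset M \<subseteq> V \<or> (\<exists>u\<in>set_mset M. \<exists>v\<in>set_mset M. E u v)"
proof -
  have "{#u, v#} \<subseteq># M \<longleftrightarrow> u \<in># M \<and> v \<in># M" if "E u v" for u v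
    using that E_irrefl by (intro pair_subset_mset) auto
  then show ?thesis unfolding power_set_1 by blast
qed

text \<open>\<open>K\<close> says that beyond the edge ideal J has only generators supported on
  \<open>T1\<close>, and \<open>sq\<close> that repeated variables matter only through squares in J.
  Once all vertices except the centres are decided, the ideal is generated by variables, and the
  disjoint stars provide at least s free ones.\<close>

lemma regular_mod_piece:
  assumes up: "upset J" and N1: "power_set (Suc 0) \<subseteq> J" and T1: "T1 \<subseteq> V"
    and K: "\<And>M. M \<in> J \<Longrightarrow> M \<notin> power_set (Suc 0) \<Longrightarrow> \<exists>M0. M0 \<subseteq># M \<and> M0 \<in> J \<and> set_mset M0 \<subseteq> T1"
    and sq: "\<And>u M. M + {#u, u#} \<in> J \<Longrightarrow> {#u, u#} \<in> J \<or> M + {#u#} \<in> J"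
    and packing: "\<And>S. S \<subseteq> T1 \<Longrightarrow> mset_set S \<notin> J \<Longrightarrow>
      \<exists>C. C \<subseteq> V - T1 \<and> s \<le> card C \<and> (\<forall>c\<in>C. \<forall>u\<in>S. {#u, u#} \<in> J \<longrightarrow> \<not> E c u)
        \<and> (\<forall>c\<in>C. \<forall>c'\<in>C. c \<noteq> c' \<longrightarrow> \<not> E c c' \<and> (\<forall>u. \<not> (E c u \<and> E c' u)))"
  shows "regular_mod (\<lambda>i. esym V (Suc i) :: ('v, 'k::comm_ring_1) mpoly) s J"
proof (rule regular_mod_branch[of T1])
  show "finite T1" using T1 finite_V finite_subset by blast
  show "upset J" by (rule up)
  fix S0 assume S0: "S0 \<subseteq> T1" "mset_set S0 \<notin> J"
  \<comment> \<open>The centres may depend on which vertices of \<open>T1\<close> are divided out.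
    Therefore \<open>T1\<close> is branched on before the remaining vertices.\<close>
  from packing[OF S0] obtain C where C: "C \<subseteq> V - T1" "s \<le> card C"
    and CS': "\<forall>c\<in>C. \<forall>u\<in>S0. {#u, u#} \<in> J \<longrightarrow> \<not> E c u"
    and CC': "\<forall>c\<in>C. \<forall>c'\<in>C. c \<noteq> c' \<longrightarrow> \<not> E c c' \<and> (\<forall>u. \<not> (E c u \<and> E c' u))"
    by (elim exE conjE)
  have CS: "\<not> E c u" if "c \<in> C" "u \<in> S0" "{#u, u#} \<in> J" for c u using CS' that by blast
  have CC: "\<not> E c c' \<and> \<not> (E c u \<and> E c' u)" if "c \<in> C" "c' \<in> C" "c \<noteq> c'" for c c' u
    using CC' that by blast
  let ?J0 = "colon J (mset_set S0) \<union> nonface (- (T1 - S0))"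
  let ?T = "V - T1 - C"
  show "regular_mod (\<lambda>i. esym V (Suc i) :: ('v, 'k) mpoly) s ?J0"
  proof (rule regular_mod_branch[of ?T])
    show "finite ?T" using finite_V by simp
    show "upset ?J0" by (intro upset_Un upset_colon upset_nonface up)
    fix S1 assume S1: "S1 \<subseteq> ?T" "mset_set S1 \<notin> ?J0"
    define S where "S = S0 \<union> S1"
    have fin: "finite S0" "finite S1" "finite S"
      using S0 S1 T1 finite_V finite_subset by (auto simp: S_def intro: finite_subset)
    have mS: "mset_set S = mset_set S0 + mset_set S1"
      unfolding S_def using fin S0 S1 by (intro mset_set_Union) auto
    then have SJ: "mset_set S \<notin> J" using S1(2) by (simp add: colon_def)
    have SV: "S \<subseteq> V" "S \<inter> C = {}" "S \<inter> T1 = S0"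
      using S0 S1 T1 C by (auto simp: S_def)
    have finJ: "{#} \<notin> J" using SJ upsetD[OF up, of "{#}" "mset_set S"] by auto
    \<comment> \<open>The square of a vertex is not in the edge ideal, so a generator on
      \<open>T1\<close> divides it.\<close>
    have sqT: "u \<in> T1" if uu: "{#u, u#} \<in> J" "u \<in> V" for u
    proof -
      have "{#u, u#} \<notin> power_set (Suc 0)" using uu(2) E_irrefl by (auto simp: power_set_1_iff)
      then obtain M0 where "M0 \<subseteq># {#u, u#}" "M0 \<in> J" "set_mset M0 \<subseteq> T1"
        using K[OF uu(1)] by blast
      moreover from this have "M0 \<noteq> {#}" using finJ by blast
      ultimately show ?thesis using set_mset_mono[of M0 "{#u, u#}"] by auto
    qed
    \<comment> \<open>These are the free variables. A vertex of S whose square is in J is killed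
      since S already supplies one factor; a centre with a neighbour in S is killed by that
      edge.\<close>
    define F where "F = {u \<in> S. {#u, u#} \<notin> J} \<union> {c \<in> C. \<forall>u\<in>S. \<not> E c u}"
    have FV: "F \<subseteq> V" using SV C by (auto simp: F_def)
    have "s \<le> card F"
    proof -
      \<comment> \<open>Each centre is sent to a free vertex of its own star: a neighbour in S if
        there is one, otherwise itself. Disjointness of the stars makes this injective.\<close>
      define h where "h c = (if \<exists>u\<in>S. E c u then SOME u. u \<in> S \<and> E c u else c)" for c
      have h: "h c \<in> S \<and> E c (h c)" if ex: "\<exists>u\<in>S. E c u" for c
        unfolding h_def if_P[OF ex] using ex unfolding Bex_def by (rule someI_ex)
      have h': "h c = c" if "\<not> (\<exists>u\<in>S. E c u)" for c using that by (simp add: h_def)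
      have "inj_on h C"
      proof (rule inj_onI, rule ccontr)
        fix c c' assume c: "c \<in> C" "c' \<in> C" "h c = h c'" "c \<noteq> c'"
        consider "\<exists>u\<in>S. E c u" "\<exists>u\<in>S. E c' u" | "\<not> (\<exists>u\<in>S. E c u)" | "\<not> (\<exists>u\<in>S. E c' u)"
          by blast
        then show False
        proof cases
          case 1
          then show False using h[OF 1(1)] h[OF 1(2)] CC[OF c(1,2,4), of "h c"] c(3) by simp
        next
          case 2
          then show False using h'[OF 2] h[of c'] h'[of c'] c SV(2) by (metis IntI empty_iff)
        next
          case 3
          then show False using h'[OF 3] h[of c] h'[of c] c SV(2) by (metis IntI empty_iff)
        qed
      qed
      moreover have "h c \<in> F" if c: "c \<in> C" for c
      proof (cases "\<exists>u\<in>S. E c u")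
        case True
        have "{#h c, h c#} \<notin> J"
        proof
          assume J: "{#h c, h c#} \<in> J"
          have "h c \<in> S0" using sqT[OF J] h[OF True] SV by blast
          then show False using CS[OF c _ J] h[OF True] by blast
        qed
        then show ?thesis using h[OF True] by (simp add: F_def)
      next
        case False
        then show ?thesis using h'[OF False] c by (auto simp: F_def)
      qed
      ultimately have "card C \<le> card F"
        using finite_subset[OF FV finite_V] by (intro card_inj_on_le[of h]) auto
      then show ?thesis using C(2) by simp
    qed
    have "- (T1 - S0) \<inter> - (?T - S1) = - (V - C - S)"
      using S0(1) S1(1) C(1) T1 by (auto simp: S_def)
    moreover have "set_mset (mset_set S1) \<subseteq> - (T1 - S0)" using S1(1) fin(2) by auto
    ultimately have "colon ?J0 (mset_set S1) \<union> nonface (- (?T - S1))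
        = colon J (mset_set S) \<union> nonface (- (V - C - S))"
      by (simp add: mS colon_Un colon_colon colon_nonface Un_assoc nonface_Un)
    also have "\<dots> = nonface F"
    proof (intro equalityI subsetI)
      fix M assume M: "M \<in> colon J (mset_set S) \<union> nonface (- (V - C - S))"
      show "M \<in> nonface F"
      proof (rule ccontr)
        assume "M \<notin> nonface F"
        then have MF: "set_mset M \<subseteq> F" by (simp add: nonface_def)
        then have "M \<notin> nonface (- (V - C - S))" by (auto simp: nonface_def F_def)
        then have MS: "mset_set S + M \<in> J" using M by (simp add: colon_def)
        let ?P = "set_mset M \<union> S"
        \<comment> \<open>A variable repeated in the product of S and M occurs in M, hence lies in
          F, and no variable of F has its square in J; for a centre this is
          \<open>sqT\<close>.\<close>
        have "mset_set (set_mset (mset_set S + M)) \<in> J"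
        proof (rule squarefree_part_mem[OF sq MS])
          fix u assume u: "{#u, u#} \<subseteq># mset_set S + M"
          have "u \<in># M"
          proof (rule ccontr)
            assume "u \<notin># M"
            then have "count (mset_set S + M) u \<le> 1" by (simp add: not_in_iff count_mset_set')
            then show False using mset_subset_eq_count[OF u, of u] by simp
          qed
          then show "{#u, u#} \<notin> J" using MF sqT[of u] C(1) by (auto simp: F_def)
        qed
        then have P: "mset_set ?P \<in> J" using fin by (simp add: Un_commute)
        have finP: "finite ?P" using fin by simp
        have notin: "mset_set ?P \<notin> power_set (Suc 0)"
        proof
          assume "mset_set ?P \<in> power_set (Suc 0)"
          then obtain a b where ab: "a \<in> ?P" "b \<in> ?P" "E a b"
            using MF FV SV(1) finP unfolding power_set_1_iff by auto
          have "\<not> (a \<in> S \<and> b \<in> S)"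
          proof
            assume "a \<in> S \<and> b \<in> S"
            then have "mset_set S \<in> power_set (Suc 0)"
              using ab(3) fin SV(1) by (auto simp: power_set_1_iff)
            then show False using SJ N1 by blast
          qed
          then show False
            using ab MF CC[of a b] E_sym[OF ab(3)] E_irrefl by (auto simp: F_def)
        qed
        obtain M0 where M0: "M0 \<subseteq># mset_set ?P" "M0 \<in> J" "set_mset M0 \<subseteq> T1"
          using K[OF P notin] by blast
        \<comment> \<open>\<open>?P\<close> adds only centres to S, and \<open>T1\<close> contains
          no centre, so the generator already divides the product over S.\<close>
        have "M0 \<subseteq># mset_set S"
        proof (rule mset_subset_eqI)
          fix a
          have "count M0 a \<le> count (mset_set ?P) a" using M0(1) by (rule mset_subset_eq_count)
          moreover have "a \<notin># M0" if "a \<notin> S"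
            using that MF M0(1,3) C(1) finP set_mset_mono[OF M0(1)] by (auto simp: F_def)
          ultimately show "count M0 a \<le> count (mset_set S) a"
            using finP fin by (cases "a \<in> S") (auto simp: not_in_iff)
        qed
        then show False using upsetD[OF up M0(2)] SJ by blast
      qed
    next
      fix M assume "M \<in> nonface F"
      then obtain v where v: "v \<in># M" "v \<notin> F" by (auto simp: nonface_def)
      have "mset_set S + M \<in> J" if vCS: "v \<in> C \<union> S \<or> v \<notin> V"
      proof -
        consider "v \<notin> V" | "v \<in> S" "{#v, v#} \<in> J" | u where "v \<in> C" "u \<in> S" "E v u"
          using vCS v(2) unfolding F_def by blast
        then show ?thesis
        proof cases
          case 1
          then have "mset_set S + M \<in> power_set (Suc 0)" using v by (auto simp: power_set_1_iff)
          then show ?thesis using N1 by blast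
        next
          case 2
          have "{#v#} + {#v#} \<subseteq># mset_set S + M"
            using 2 v fin by (intro subset_mset.add_mono) auto
          then show ?thesis using upsetD[OF up 2(2)] by simp
        next
          case 3
          then have "mset_set S + M \<in> power_set (Suc 0)"
            using v fin by (auto simp: power_set_1_iff)
          then show ?thesis using N1 by blast
        qed
      qed
      then show "M \<in> colon J (mset_set S) \<union> nonface (- (V - C - S))"
        using v by (auto simp: colon_def nonface_def)
    qed
    finally show "regular_mod (\<lambda>i. esym V (Suc i) :: ('v, 'k) mpoly) s
        (colon ?J0 (mset_set S1) \<union> nonface (- (?T - S1)))"
      using regular_mod_mono[OF regular_mod_nonface[OF finite_V FV] \<open>s \<le> card F\<close>] by simp
  qed
qed

end

section \<open>Products of edges\<close>

lemma subset_mset_split: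
  assumes "Q + R \<subseteq># L + M" "\<And>q. q \<in># Q \<Longrightarrow> q \<notin># M"
  shows "Q \<subseteq># L" "R \<subseteq># (L - Q) + M"
proof -
  have c: "count Q a + count R a \<le> count L a + count M a" for a
    using assms(1) by (auto simp: subseteq_mset_def)
  show Q: "Q \<subseteq># L"
  proof (rule mset_subset_eqI)
    fix a show "count Q a \<le> count L a"
      using c[of a] assms(2)[of a] by (cases "a \<in># Q") (auto simp: not_in_iff)
  qed
  show "R \<subseteq># (L - Q) + M"
  proof (rule mset_subset_eqI)
    fix a show "count R a \<le> count ((L - Q) + M) a"
      using c[of a] mset_subset_eq_count[OF Q, of a] by simp
  qed
qed

lemma subset_mset_repeat:
  assumes "R \<subseteq># X + {#u, u#}" "\<not> R \<subseteq># X + {#u#}"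
  shows "{#u, u#} \<subseteq># R"
proof -
  obtain a where a: "\<not> count R a \<le> count (X + {#u#}) a"
    using assms(2) by (auto simp: subseteq_mset_def)
  moreover have "count R a \<le> count (X + {#u, u#}) a" using assms(1) by (rule mset_subset_eq_count)
  ultimately have "a = u" "2 \<le> count R u" by (auto split: if_splits)
  then show ?thesis by (auto simp: subseteq_mset_def)
qed

lemma subset_mset_size_eq: "A \<subseteq># B \<Longrightarrow> size B \<le> size A \<Longrightarrow> A = B"
  by (metis mset_subset_size nless_le not_le subset_mset.less_le)

context simple_graph
begin

lemma products_1: "M \<in> products (Suc 0) \<longleftrightarrow> (\<exists>u v. M = {#u, v#} \<and> E u v)"
  by auto

lemma products_2: "E a b \<Longrightarrow> E c d \<Longrightarrow> {#a, b, c, d#} \<in> products 2"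
  by (force simp: numeral_2_eq_2)

lemma products_3: "E a b \<Longrightarrow> E c d \<Longrightarrow> E e f \<Longrightarrow> {#a, b, c, d, e, f#} \<in> products 3"
  by (force simp: numeral_3_eq_3)

lemma products_V: "M \<in> products n \<Longrightarrow> set_mset M \<subseteq> V"
proof (induction n arbitrary: M)
  case (Suc n)
  then obtain u v P where "M = {#u, v#} + P" "E u v" "P \<in> products n" by auto
  then show ?case using Suc.IH[of P] E_V[of u v] E_V[of v u] E_sym[of u v] by simp
qed simp

text \<open>An edge with both ends in M would put M into the edge ideal, so every edge has an end
  outside M, which becomes its head. If the product of the edges divides \<open>L + M\<close>, all
  heads must come from L.\<close>

lemma products_orient:
  assumes "P \<in> products n" "M \<notin> power_set (Suc 0)"
  shows "\<exists>D. size D = n \<and> P = image_mset fst D + image_mset snd D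
      \<and> (\<forall>(p, q) \<in># D. E p q \<and> q \<notin># M)"
  using assms(1)
proof (induction n arbitrary: P)
    case (Suc n)
    then obtain u v P' where P: "P = {#u, v#} + P'" "E u v" "P' \<in> products n" by auto
    obtain D where D: "size D = n" "P' = image_mset fst D + image_mset snd D"
      "\<forall>(p, q) \<in># D. E p q \<and> q \<notin># M"
      using Suc.IH[OF P(3)] by blast
    have "\<not> (u \<in># M \<and> v \<in># M)" using assms(2) P(2) by (auto simp: power_set_1_iff)
    then show ?case
    proof (cases "v \<in># M")
      case True
      then show ?thesis using D P E_sym[OF P(2)] \<open>\<not> (u \<in># M \<and> v \<in># M)\<close>
        by (intro exI[of _ "add_mset (v, u) D"]) auto
    next
      case False
      then show ?thesis using D P by (intro exI[of _ "add_mset (u, v) D"]) auto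
    qed
qed simp

section \<open>Annihilators of the factors of the filtration\<close>

definition nbs :: "'v multiset \<Rightarrow> 'v set" where
  "nbs L = {p. \<exists>q\<in>#L. E p q}"

text \<open>
  The annihilator of the class of \<open>L\<close> when the quotient of the \<open>n\<close>-th by the next power of the edge
  ideal is filtered by the products of \<open>n\<close> edges; \<open>T\<close> consists of the products adjoined before \<open>L\<close>.
\<close>

definition piece :: "nat \<Rightarrow> 'v multiset set \<Rightarrow> 'v multiset \<Rightarrow> 'v multiset set" where
  "piece n T L = colon (power_set (Suc n) \<union> multiples T) L"

lemma upset_piece: "upset (piece n T L)"
  by (simp add: piece_def upset_colon upset_Un upset_power_set upset_multiples)

lemma pieceI: "P \<in> products (Suc n) \<union> T \<Longrightarrow> P \<subseteq># L + M \<Longrightarrow> M \<in> piece n T L"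
  by (auto simp: piece_def colon_def power_set_def multiples_def)

lemma power_set_1_piece:
  assumes "L \<in> products n"
  shows "power_set (Suc 0) \<subseteq> piece n T L"
proof
  fix M assume "M \<in> power_set (Suc 0)"
  then consider "\<not> set_mset M \<subseteq> V" | u v where "E u v" "{#u, v#} \<subseteq># M"
    unfolding power_set_1 by blast
  then show "M \<in> piece n T L"
  proof cases
    case 1
    then show ?thesis by (auto simp: piece_def colon_def power_set_def nonface_def)
  next
    case 2
    have "{#u, v#} + L \<in> products (Suc n)" using 2 assms by auto
    moreover have "{#u, v#} + L \<subseteq># L + M"
      using 2(2) subset_mset.add_mono[of "{#u, v#}" M L L] by (simp add: add.commute)
    ultimately show ?thesis using pieceI by blast
  qed
qed

text \<open>Membership of M means that L M is divisible by n + 1 edges or by a product adjoined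
  earlier. With the edges oriented towards L, the heads consume part of L, and the tails come from
  the rest of L and from M.\<close>

lemma pieceE:
  assumes "M \<in> piece n T L" "M \<notin> power_set (Suc 0)" "L \<in> products n" "T \<subseteq> products n"
  obtains D where "image_mset fst D + image_mset snd D \<in> products (Suc n) \<and> size D = Suc n
        \<or> image_mset fst D + image_mset snd D \<in> T \<and> size D = n"
    "\<forall>(p, q) \<in># D. E p q"
    "image_mset snd D \<subseteq># L" "image_mset fst D \<subseteq># (L - image_mset snd D) + M"
proof -
  have "set_mset M \<subseteq> V" using assms(2) by (auto simp: power_set_1)
  then have "set_mset (L + M) \<subseteq> V" using products_V[OF assms(3)] by simp
  then have "\<exists>P. (P \<in> products (Suc n) \<or> P \<in> T) \<and> P \<subseteq># L + M"
    using assms(1) unfolding piece_def colon_def power_set_def nonface_def multiples_def by blast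
  then obtain P k where P: "P \<in> products (Suc n) \<and> k = Suc n \<or> P \<in> T \<and> k = n" "P \<subseteq># L + M"
    by blast
  then have "P \<in> products k" using assms(4) by blast
  from products_orient[OF this assms(2)]
  obtain D where D: "size D = k" "P = image_mset fst D + image_mset snd D"
    "\<forall>(p, q) \<in># D. E p q \<and> q \<notin># M"
    by blast
  have sub: "image_mset snd D + image_mset fst D \<subseteq># L + M" using P(2) D(2) by (simp add: add.commute)
  have notin: "q \<notin># M" if "q \<in># image_mset snd D" for q using that D(3) by auto
  have "image_mset snd D \<subseteq># L" "image_mset fst D \<subseteq># (L - image_mset snd D) + M"
    using subset_mset_split[OF sub notin] by blast+
  moreover have "\<forall>(p, q) \<in># D. E p q" using D(3) by blast
  ultimately show ?thesis using that[of D] D P by blast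
qed

text \<open>Only the tails not supplied by the rest of L must be taken from M, and each tail is
  adjacent to its head in L.\<close>

lemma piece_generators:
  assumes "M \<in> piece n T L" "M \<notin> power_set (Suc 0)" "L \<in> products n" "T \<subseteq> products n"
  shows "\<exists>M0. M0 \<subseteq># M \<and> M0 \<in> piece n T L \<and> set_mset M0 \<subseteq> nbs L"
proof -
  obtain D where D: "image_mset fst D + image_mset snd D \<in> products (Suc n) \<union> T"
    "\<forall>(p, q) \<in># D. E p q"
    "image_mset snd D \<subseteq># L" "image_mset fst D \<subseteq># (L - image_mset snd D) + M"
    using pieceE[OF assms] by (metis UnI1 UnI2)
  let ?Q = "image_mset snd D" and ?R = "image_mset fst D"
  let ?M0 = "?R - (L - ?Q)"
  have "?M0 \<subseteq># M" using D(4) by (simp add: subset_eq_diff_conv add.commute)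
  moreover have "?R + ?Q \<subseteq># L + ?M0"
  proof -
    have Q: "count ?Q a \<le> count L a" for a using D(3) by (rule mset_subset_eq_count)
    show ?thesis
    proof (rule mset_subset_eqI)
      fix a show "count (?R + ?Q) a \<le> count (L + ?M0) a" using Q[of a] by simp
    qed
  qed
  moreover have "set_mset ?M0 \<subseteq> nbs L"
  proof
    fix p assume "p \<in># ?M0"
    then have "p \<in># ?R" by (rule in_diffD)
    then obtain q where q: "(p, q) \<in># D" by auto
    then have "q \<in># ?Q" by force
    then have "q \<in># L" using D(3) by (rule mset_subset_eqD[rotated])
    then show "p \<in> nbs L" using D(2) q by (auto simp: nbs_def)
  qed
  ultimately show ?thesis using pieceI[OF D(1)] by blast
qed

lemma image_snd_eq_add_mset:
  assumes "image_mset snd D = add_mset q Q" "\<forall>(p, q) \<in># D. E p q"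
  shows "\<exists>p D'. D = add_mset (p, q) D' \<and> E p q \<and> image_mset snd D' = Q \<and> (\<forall>(p, q) \<in># D'. E p q)"
proof -
  obtain D' a where D: "D = add_mset a D'" "snd a = q" "image_mset snd D' = Q"
    using msed_map_invR[OF assms(1)] by blast
  then show ?thesis using assms(2) by (intro exI[of _ "fst a"] exI[of _ D']) auto
qed

text \<open>
  Here \<open>D\<close> lists three edges inside \<open>L + M\<close>, oriented towards \<open>L\<close>; \<open>r\<close> is the vertex of \<open>L\<close> that is
  not the head of an edge.
\<close>

lemma three_edges:
  assumes D: "size D = 3" "\<forall>(p, q) \<in># D. E p q" "image_mset snd D \<subseteq># L"
      "image_mset fst D \<subseteq># (L - image_mset snd D) + M"
    and L: "L = {#x, y, z, w#}"
  obtains q1 q2 q3 r p1 p2 p3 where "image_mset fst D = {#p1, p2, p3#}"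
    "{#p1, p2, p3#} \<subseteq># add_mset r M" "E p1 q1" "E p2 q2" "E p3 q3"
    "{#q1, q2#} = {#x, y#} \<and> {#q3, r#} = {#z, w#} \<or> {#q1, q2#} = {#z, w#} \<and> {#q3, r#} = {#x, y#}"
proof -
  note that0 = that
  let ?Q = "image_mset snd D"
  have "size (L - ?Q) = 1" using D(1,3) L by (simp add: size_Diff_submset)
  then obtain r where r: "L - ?Q = {#r#}" using size_1_singleton_mset by blast
  then have LQ: "add_mset r ?Q = {#x, y, z, w#}"
    using D(3) L by (metis add_mset_add_single subset_mset.add_diff_inverse)
  have fin: thesis
    if Q: "?Q = {#q1, q2, q3#}"
      "{#q1, q2#} = {#x, y#} \<and> {#q3, r#} = {#z, w#} \<or> {#q1, q2#} = {#z, w#} \<and> {#q3, r#} = {#x, y#}"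
    for q1 q2 q3
  proof -
    obtain p1 D1 where D1: "D = add_mset (p1, q1) D1" "E p1 q1" "image_mset snd D1 = {#q2, q3#}"
      "\<forall>(p, q) \<in># D1. E p q"
      using image_snd_eq_add_mset[OF Q(1) D(2)] by blast
    obtain p2 D2 where D2: "D1 = add_mset (p2, q2) D2" "E p2 q2" "image_mset snd D2 = {#q3#}"
      "\<forall>(p, q) \<in># D2. E p q"
      using image_snd_eq_add_mset[OF D1(3,4)] by blast
    obtain p3 D3 where D3: "D2 = add_mset (p3, q3) D3" "E p3 q3" "image_mset snd D3 = {#}"
      using image_snd_eq_add_mset[OF D2(3,4)] by blast
    have "image_mset fst D = {#p1, p2, p3#}" using D1(1) D2(1) D3(1,3) by simp
    then show ?thesis using that0[of p1 p2 p3 r q1 q2 q3] D1(2) D2(2) D3(2) Q(2) D(4) r by simp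
  qed
  have "r \<in># {#x, y, z, w#}" using LQ by (metis union_single_eq_member)
  then consider "r = x" | "r = y" | "r = z" | "r = w" by auto
  then show thesis
  proof cases
    case 1
    then have "?Q = {#z, w, y#}" using LQ by (simp add: add_mset_commute)
    then show ?thesis by (rule fin) (simp add: 1 add_mset_commute)
  next
    case 2
    then have "add_mset y ?Q = add_mset y {#z, w, x#}" using LQ by (simp add: add_mset_commute)
    then have "?Q = {#z, w, x#}" by simp
    then show ?thesis by (rule fin) (simp add: 2 add_mset_commute)
  next
    case 3
    then have "add_mset z ?Q = add_mset z {#x, y, w#}" using LQ by (simp add: add_mset_commute)
    then have "?Q = {#x, y, w#}" by simp
    then show ?thesis by (rule fin) (simp add: 3 add_mset_commute)
  next
    case 4
    then have "add_mset w ?Q = add_mset w {#x, y, z#}" using LQ by (simp add: add_mset_commute)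
    then have "?Q = {#x, y, z#}" by simp
    then show ?thesis by (rule fin) (simp add: 4 add_mset_commute)
  qed
qed

end

lemma pair_mset_eq: "{#a, b#} = {#c, d#} \<longleftrightarrow> a = c \<and> b = d \<or> a = d \<and> b = c"
  by (auto simp: add_eq_conv_diff)

lemma triple_mset_eq:
  "{#p1, p2, p3#} = {#r, u, u#} \<Longrightarrow>
    p1 = r \<and> p2 = u \<and> p3 = u \<or> p1 = u \<and> p2 = r \<and> p3 = u \<or> p1 = u \<and> p2 = u \<and> p3 = r"
  by (auto simp: add_eq_conv_diff)

context simple_graph
begin

text \<open>The generators of a piece involve each variable at most linearly or are squares.\<close>

lemma piece_square:
  assumes M: "M + {#u, u#} \<in> piece n T L" and L: "L \<in> products n" and T: "T \<subseteq> products n"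
    and n: "n \<le> 2"
  shows "{#u, u#} \<in> piece n T L \<or> M + {#u#} \<in> piece n T L"
proof (rule ccontr)
  assume "\<not> ?thesis"
  then have uu: "{#u, u#} \<notin> piece n T L" and Mu: "M + {#u#} \<notin> piece n T L" by auto
  have "M + {#u#} \<notin> power_set (Suc 0)" using Mu power_set_1_piece[OF L] by blast
  then have notin: "M + {#u, u#} \<notin> power_set (Suc 0)" by (simp add: power_set_1_iff)
  obtain D where D: "image_mset fst D + image_mset snd D \<in> products (Suc n) \<and> size D = Suc n
        \<or> image_mset fst D + image_mset snd D \<in> T \<and> size D = n"
    "\<forall>(p, q) \<in># D. E p q"
    "image_mset snd D \<subseteq># L" "image_mset fst D \<subseteq># (L - image_mset snd D) + (M + {#u, u#})"
    using pieceE[OF M notin L T] by blast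
  let ?Q = "image_mset snd D" and ?R = "image_mset fst D"
  have P: "?R + ?Q \<in> products (Suc n) \<union> T" using D(1) by blast
  have "\<not> ?R \<subseteq># (L - ?Q + M) + {#u#}"
  proof
    assume "?R \<subseteq># (L - ?Q + M) + {#u#}"
    then have "?R + ?Q \<subseteq># ((L - ?Q + M) + {#u#}) + ?Q" by (rule subset_mset.add_right_mono)
    also have "((L - ?Q + M) + {#u#}) + ?Q = (L - ?Q + ?Q) + (M + {#u#})" by (simp only: ac_simps)
    also have "L - ?Q + ?Q = L" using D(3) by (rule subset_mset.diff_add)
    finally show False using pieceI[OF P] Mu by blast
  qed
  moreover have "?R \<subseteq># (L - ?Q + M) + {#u, u#}" using D(4) by (simp only: add.assoc)
  ultimately have uR: "{#u, u#} \<subseteq># ?R" by (rule subset_mset_repeat[rotated])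
  have R: "?R \<noteq> {#u, u#}"
  proof
    assume "?R = {#u, u#}"
    then have "?R + ?Q \<subseteq># L + {#u, u#}" using D(3) by (simp add: add.commute)
    then show False using pieceI[OF P] uu by blast
  qed
  then have "size ?R \<noteq> 2" using subset_mset_size_eq[OF uR] by auto
  moreover have "2 \<le> size ?R" using size_mset_mono[OF uR] by simp
  \<comment> \<open>The tails include u twice and something else, so there are at least three edges,
    while at most n + 1 \<le> 3 are available.\<close>
  ultimately have "size D = 3 \<and> n = 2" using D(1) n by fastforce
  then have D3: "size D = 3" and n2: "n = 2" by auto
  obtain x y z w where Leq: "L = {#x, y, z, w#}" "E x y" "E z w"
    using L n2 by (auto simp: numeral_2_eq_2)
  obtain q1 q2 q3 r p1 p2 p3 where p: "?R = {#p1, p2, p3#}" "{#p1, p2, p3#} \<subseteq># add_mset r (M + {#u, u#})"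
    "E p1 q1" "E p2 q2" "E p3 q3"
    "{#q1, q2#} = {#x, y#} \<and> {#q3, r#} = {#z, w#} \<or> {#q1, q2#} = {#z, w#} \<and> {#q3, r#} = {#x, y#}"
    by (rule three_edges[OF D3 D(2-4) Leq(1)])
  have L': "L = {#q1, q2, q3, r#}"
  proof -
    have "{#q1, q2#} + {#q3, r#} = {#x, y#} + {#z, w#}"
      using p(6)
    proof (elim disjE conjE)
      assume "{#q1, q2#} = {#z, w#}" "{#q3, r#} = {#x, y#}"
      then show ?thesis by (simp only: add.commute)
    qed (simp only:)
    then show ?thesis using Leq(1) by (simp add: add_mset_commute)
  qed
  have q: "E q1 q2" "E q3 r"
    using p(6) Leq(2,3) E_sym by (auto simp: pair_mset_eq)
  have in_piece: "N \<in> piece n T L" if "A \<in> products 3" "A \<subseteq># L + N" for A N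
    using pieceI[of A n T L N] that n2 by simp
  have mem: "v = r \<or> v \<in># M" if "v \<in># ?R" "v \<noteq> u" for v
    using mset_subset_eqD[OF p(2)] that p(1) by auto
  have two: "N \<in> piece n T L" if "N = M + {#u#}" "v \<in># M" "A \<in> products 3" "A = L + {#u, v#}" for N v A
  proof -
    have "{#v#} \<subseteq># M" using that(2) by simp
    then have "A \<subseteq># L + N" using that by (simp add: add_mset_commute)
    then show ?thesis using in_piece that(3) by blast
  qed
  \<comment> \<open>Two tails equal u. In each case three edges are found inside L u u, or inside L
    u v where v is the third tail and lies in M.\<close>
  have "u = p1 \<and> u = p2 \<or> u = p1 \<and> u = p3 \<and> u \<noteq> p2 \<or> u = p2 \<and> u = p3 \<and> u \<noteq> p1"
    using uR unfolding p(1) by (auto simp: insert_subset_eq_iff split: if_splits)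
  then show False
  proof (elim disjE conjE)
    assume "u = p1" "u = p2"
    then have "{#u, q1, u, q2, q3, r#} \<in> products 3" using p q by (intro products_3) auto
    then show False using in_piece[of _ "{#u, u#}"] uu L' by (auto simp: add_mset_commute)
  next
    assume u: "u = p1" "u = p3" "u \<noteq> p2"
    have "p2 = r \<or> p2 \<in># M" using mem[of p2] p(1) u by auto
    then show False
    proof
      assume "p2 = r"
      then have "{#u, q1, u, q3, r, q2#} \<in> products 3" using p u by (intro products_3) auto
      then show False using in_piece[of _ "{#u, u#}"] uu L' by (auto simp: add_mset_commute)
    next
      assume "p2 \<in># M"
      \<comment> \<open>The edge \<open>q3 r\<close> of L replaces the edge \<open>u q3\<close>,
        which saves one of the two copies of u.\<close>
      have "{#u, q1, p2, q2, q3, r#} \<in> products 3" using p u q by (intro products_3) auto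
      then show False using two[OF refl \<open>p2 \<in># M\<close>] Mu L' by (auto simp: add_mset_commute)
    qed
  next
    assume u: "u = p2" "u = p3" "u \<noteq> p1"
    have "p1 = r \<or> p1 \<in># M" using mem[of p1] p(1) u by auto
    then show False
    proof
      assume "p1 = r"
      then have "{#u, q2, u, q3, r, q1#} \<in> products 3" using p u by (intro products_3) auto
      then show False using in_piece[of _ "{#u, u#}"] uu L' by (auto simp: add_mset_commute)
    next
      assume "p1 \<in># M"
      have "{#p1, q1, u, q2, q3, r#} \<in> products 3" using p u q by (intro products_3) auto
      then show False using two[OF refl \<open>p1 \<in># M\<close>] Mu L' by (auto simp: add_mset_commute)
    qed
  qed
qed

text \<open>
  The alternatives are a triangle on one of the edges \<open>ab\<close>, \<open>cd\<close> and a closed walk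
  \<open>u a1 a2 c2 c1 u\<close> of length five.
\<close>

lemma piece_two_odd_walk:
  fixes w :: "'v \<Rightarrow> nat"
  assumes w: "inj_on w V" and L: "L = {#a, b, c, d#}" "E a b" "E c d"
    and T: "T \<subseteq> products 2 - {L}" "{M \<in> products 2. (\<Sum>v\<in>#M. w v) < (\<Sum>v\<in>#L. w v)} \<subseteq> T"
      "\<forall>M\<in>T. (\<Sum>v\<in>#M. w v) \<le> (\<Sum>v\<in>#L. w v)"
    and u: "u \<in> V" "{#u, u#} \<in> piece 2 T L" "{#u#} \<notin> piece 2 T L"
  shows "E u a \<and> E u b \<or> E u c \<and> E u d \<or>
    (\<exists>a1 a2 c1 c2. {#a1, a2#} = {#a, b#} \<and> {#c1, c2#} = {#c, d#} \<and> E u a1 \<and> E u c1 \<and> E a2 c2)"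
proof -
  have LP: "L \<in> products 2" unfolding L(1) by (rule products_2) (rule L)+
  have notin: "{#u, u#} \<notin> power_set (Suc 0)" using u(1) E_irrefl by (simp add: power_set_1_iff)
  have T2: "T \<subseteq> products 2" using T(1) by blast
  obtain D where D: "image_mset fst D + image_mset snd D \<in> products (Suc 2) \<and> size D = Suc 2
        \<or> image_mset fst D + image_mset snd D \<in> T \<and> size D = 2"
    "\<forall>(p, q) \<in># D. E p q"
    "image_mset snd D \<subseteq># L" "image_mset fst D \<subseteq># (L - image_mset snd D) + {#u, u#}"
    using pieceE[OF u(2) notin LP T2] by blast
  let ?Q = "image_mset snd D" and ?R = "image_mset fst D"
  show ?thesis
  proof (cases "size D = 3")
    case True
    obtain q1 q2 q3 r p1 p2 p3 where p: "?R = {#p1, p2, p3#}" "{#p1, p2, p3#} \<subseteq># add_mset r {#u, u#}"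
      "E p1 q1" "E p2 q2" "E p3 q3"
      "{#q1, q2#} = {#a, b#} \<and> {#q3, r#} = {#c, d#} \<or> {#q1, q2#} = {#c, d#} \<and> {#q3, r#} = {#a, b#}"
      by (rule three_edges[OF True D(2-4) L(1)])
    \<comment> \<open>Three tails fill a multiset of size three. If u is the tail towards both
      \<open>q1\<close> and \<open>q2\<close>, it forms a triangle with that edge of L; otherwise
      the tail r closes the walk of length five.\<close>
    have "{#p1, p2, p3#} = {#r, u, u#}" using p(2) by (rule subset_mset_size_eq) simp
    note tri = triple_mset_eq[OF this]
    have close: ?thesis if "{#s1, s2#} = {#q1, q2#}" "E u s1" "E u q3" "E s2 r" "E r s2" for s1 s2
      using p(6)
    proof
      assume "{#q1, q2#} = {#a, b#} \<and> {#q3, r#} = {#c, d#}"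
      then show ?thesis
        using that by (intro disjI2 exI[of _ s1] exI[of _ s2] exI[of _ q3] exI[of _ r]) simp
    next
      assume "{#q1, q2#} = {#c, d#} \<and> {#q3, r#} = {#a, b#}"
      then show ?thesis
        using that by (intro disjI2 exI[of _ q3] exI[of _ r] exI[of _ s1] exI[of _ s2]) simp
    qed
    consider "p1 = u" "p2 = u" | "p1 = r" "p2 = u" "p3 = u" | "p2 = r" "p1 = u" "p3 = u"
      using tri by blast
    then show ?thesis
    proof cases
      case 1
      then show ?thesis using p by (auto simp: pair_mset_eq)
    next
      case 2
      then have "E u q2" "E u q3" "E q1 r" "E r q1" using p E_sym by auto
      then show ?thesis by (intro close[of q2 q1]) (auto simp: add_mset_commute)
    next
      case 3
      then have "E u q1" "E u q3" "E q2 r" "E r q2" using p E_sym by auto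
      then show ?thesis by (intro close[of q1 q2]) auto
    qed
  next
    case False
    \<comment> \<open>Here the divisor is a product of two edges adjoined before L. The weights must
      exclude that its heads come from different edges of L.\<close>
    then have PT: "?R + ?Q \<in> T" and D2: "size D = 2" using D(1) by auto
    have "\<not> ?R \<subseteq># (L - ?Q) + {#u#}"
    proof
      assume "?R \<subseteq># (L - ?Q) + {#u#}"
      then have "?R + ?Q \<subseteq># ((L - ?Q) + {#u#}) + ?Q" by (rule subset_mset.add_right_mono)
      also have "((L - ?Q) + {#u#}) + ?Q = (L - ?Q + ?Q) + {#u#}" by (simp only: ac_simps)
      also have "L - ?Q + ?Q = L" using D(3) by (rule subset_mset.diff_add)
      finally show False using pieceI[of "?R + ?Q" 2 T] PT u(3) by blast
    qed
    then have "{#u, u#} \<subseteq># ?R" by (rule subset_mset_repeat[OF D(4)])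
    then have R: "?R = {#u, u#}" using D2 by (intro subset_mset_size_eq[symmetric]) simp_all
    have "size ?Q = Suc 1" using D2 by simp
    then obtain q1 Q1 where Q1: "?Q = add_mset q1 Q1" using size_eq_Suc_imp_eq_union by blast
    then have "size Q1 = 1" using \<open>size ?Q = Suc 1\<close> by simp
    then obtain q2 where Q: "?Q = {#q1, q2#}" using size_1_singleton_mset Q1 by blast
    have Eq: "E u q" if "q \<in># ?Q" for q
    proof -
      obtain p where "(p, q) \<in># D" using \<open>q \<in># ?Q\<close> by auto
      moreover from this have "p \<in># ?R" by force
      ultimately show ?thesis using R D(2) by auto
    qed
    then have Euq: "E u q1" "E u q2" using Q by auto
    \<comment> \<open>If u is lighter than \<open>s2\<close>, exchanging the two yields a lighter
      product, adjoined earlier and dividing L u. Then u alone would annihilate L.\<close>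
    have swap: False if "E u s1" "E t1 t2" "L = {#s1, s2, t1, t2#}" "w u < w s2" for s1 s2 t1 t2
    proof -
      have "{#u, s1, t1, t2#} \<in> products 2" by (rule products_2) (rule that)+
      moreover have "(\<Sum>v\<in>#{#u, s1, t1, t2#}. w v) < (\<Sum>v\<in>#L. w v)" using that by simp
      ultimately have "{#u, s1, t1, t2#} \<in> T" using T(2) by blast
      moreover have "{#u, s1, t1, t2#} \<subseteq># L + {#u#}" unfolding that(3) by (simp add: add_mset_commute)
      ultimately show False using pieceI[of "{#u, s1, t1, t2#}" 2 T L "{#u#}"] u(3) by blast
    qed
    \<comment> \<open>The product of \<open>u s1\<close> and \<open>u t1\<close> is not heavier than
      L, which bounds twice the weight of u by the weights of \<open>s2\<close> and
      \<open>t2\<close>; \<open>swap\<close> gives the reverse bounds. By injectivity of the weight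
      u equals both, and the product would be L itself, which is not in T.\<close>
    have mixed: False if q: "E u s1" "E u t1" "{#s1, s2#} = {#a, b#}" "{#t1, t2#} = {#c, d#}"
      "?Q = {#s1, t1#}" for s1 s2 t1 t2
    proof -
      have "{#s1, s2#} + {#t1, t2#} = {#a, b#} + {#c, d#}" using q by simp
      then have L': "L = {#s1, s2, t1, t2#}" "L = {#t1, t2, s1, s2#}"
        using L(1) by (simp_all add: add_mset_commute)
      have E: "E s1 s2" "E t1 t2" using q(3,4) L(2,3) E_sym by (auto simp: pair_mset_eq)
      have "(\<Sum>v\<in>#?R + ?Q. w v) \<le> (\<Sum>v\<in>#L. w v)" using T(3) PT by blast
      then have "2 * w u \<le> w s2 + w t2" unfolding R q(5) L'(1) by simp
      moreover have "\<not> w u < w s2" using swap[OF q(1) E(2) L'(1)] by blast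
      moreover have "\<not> w u < w t2" using swap[OF q(2) E(1) L'(2)] by blast
      ultimately have "w u = w s2" "w u = w t2" by auto
      then have "u = s2" "u = t2"
        using inj_onD[OF w, of u s2] inj_onD[OF w, of u t2] u(1) E_V[OF E_sym[OF E(1)]]
          E_V[OF E_sym[OF E(2)]] by blast+
      then have "?R + ?Q = L" unfolding R q(5) L'(1) by (simp add: add_mset_commute)
      then show False using PT T(1) by blast
    qed
    have sub: "{#q1, q2#} \<subseteq># {#a, b, c, d#}" using D(3) Q L(1) by simp
    have comm: "{#b, a#} = {#a, b#}" "{#d, c#} = {#c, d#}" by simp_all
    have "q1 \<in> {a, b, c, d}" "q2 \<in> {a, b, c, d}" using set_mset_mono[OF sub] by auto
    then consider "q1 \<in> {a, b}" "q2 \<in> {c, d}" | "q2 \<in> {a, b}" "q1 \<in> {c, d}"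
      | "{#q1, q2#} = {#a, b#}" | "{#q1, q2#} = {#c, d#}"
      using sub by (auto simp: insert_subset_eq_iff split: if_splits)
    then show ?thesis
    proof cases
      case 1
      then obtain s t where "{#q1, s#} = {#a, b#}" "{#q2, t#} = {#c, d#}" using comm by blast
      then show ?thesis using mixed[OF Euq _ _ Q] by blast
    next
      case 2
      have "?Q = {#q2, q1#}" using Q by simp
      moreover obtain s t where "{#q2, s#} = {#a, b#}" "{#q1, t#} = {#c, d#}" using 2 comm by blast
      ultimately show ?thesis using mixed[OF Euq(2,1)] by blast
    next
      case 3
      then show ?thesis using Euq by (auto simp: pair_mset_eq)
    next
      case 4
      then show ?thesis using Euq by (auto simp: pair_mset_eq)
    qed
  qed
qed

end

section \<open>The third power of the edge ideal\<close>

text \<open>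
  Vertices at \<open>\<Phi>\<close>-distance at least three are nonadjacent and have no common neighbour, so the
  sets in \<open>separated\<close> are centres of disjoint stars.
\<close>

locale lipschitz_graph = simple_graph V E for V :: "'v set" and E +
  fixes \<Phi> :: "'v \<Rightarrow> int" and s :: nat
  assumes lipschitz: "E u v \<Longrightarrow> \<bar>\<Phi> u - \<Phi> v\<bar> \<le> 1"
    and separated: "\<exists>C\<subseteq>V. s \<le> card C \<and> (\<forall>c\<in>C. \<Phi> c \<notin> {a..a+3} \<union> {b..b+3})
      \<and> (\<forall>c\<in>C. \<forall>c'\<in>C. c \<noteq> c' \<longrightarrow> 3 \<le> \<bar>\<Phi> c - \<Phi> c'\<bar>)"
begin

lemma nbs_V: "nbs L \<subseteq> V"
  by (auto simp: nbs_def dest: E_V)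

text \<open>Centres have to avoid \<open>nbs L\<close>, which supports the extra generators, and the
  neighbours of vertices of S whose square lies in the piece. If two windows of four values cover
  all of these, \<open>separated\<close> supplies the centres.\<close>

lemma regular_mod_piece_cover:
  assumes L: "L \<in> products n" and T: "T \<subseteq> products n" and n: "n \<le> 2"
    and cover: "\<And>S. S \<subseteq> nbs L \<Longrightarrow> mset_set S \<notin> piece n T L \<Longrightarrow>
      \<exists>a b. \<forall>v. v \<in> nbs L \<or> (\<exists>u\<in>S. {#u, u#} \<in> piece n T L \<and> E v u) \<longrightarrow> \<Phi> v \<in> {a..a+3} \<union> {b..b+3}"
  shows "regular_mod (\<lambda>i. esym V (Suc i) :: ('v, 'k::comm_ring_1) mpoly) s (piece n T L)"
proof (rule regular_mod_piece[OF upset_piece power_set_1_piece[OF L] nbs_V])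
  show "\<exists>M0. M0 \<subseteq># M \<and> M0 \<in> piece n T L \<and> set_mset M0 \<subseteq> nbs L"
    if "M \<in> piece n T L" "M \<notin> power_set (Suc 0)" for M
    using piece_generators[OF that L T] .
  show "{#u, u#} \<in> piece n T L \<or> M + {#u#} \<in> piece n T L"
    if "M + {#u, u#} \<in> piece n T L" for u M
    using piece_square[OF that L T n] .
  fix S assume "S \<subseteq> nbs L" "mset_set S \<notin> piece n T L"
  from cover[OF this] obtain a b where ab:
    "\<And>v. v \<in> nbs L \<Longrightarrow> \<Phi> v \<in> {a..a+3} \<union> {b..b+3}"
    "\<And>u v. u \<in> S \<Longrightarrow> {#u, u#} \<in> piece n T L \<Longrightarrow> E v u \<Longrightarrow> \<Phi> v \<in> {a..a+3} \<union> {b..b+3}"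
    by blast
  obtain C where C: "C \<subseteq> V" "s \<le> card C"
    and avoid: "\<And>c. c \<in> C \<Longrightarrow> \<Phi> c \<notin> {a..a+3} \<union> {b..b+3}"
    and sep: "\<And>c c'. c \<in> C \<Longrightarrow> c' \<in> C \<Longrightarrow> c \<noteq> c' \<Longrightarrow> 3 \<le> \<bar>\<Phi> c - \<Phi> c'\<bar>"
    using separated[of a b] by blast
  show "\<exists>C. C \<subseteq> V - nbs L \<and> s \<le> card C \<and>
      (\<forall>c\<in>C. \<forall>u\<in>S. {#u, u#} \<in> piece n T L \<longrightarrow> \<not> E c u) \<and>
      (\<forall>c\<in>C. \<forall>c'\<in>C. c \<noteq> c' \<longrightarrow> \<not> E c c' \<and> (\<forall>u. \<not> (E c u \<and> E c' u)))"
  proof (intro exI[of _ C] conjI ballI impI allI)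
    show "C \<subseteq> V - nbs L" using C(1) ab(1) avoid by blast
    show "s \<le> card C" by (rule C(2))
    show "\<not> E c u" if "c \<in> C" "u \<in> S" "{#u, u#} \<in> piece n T L" for c u
      using ab(2)[OF that(2,3), of c] avoid[OF that(1)] by blast
    show "\<not> E c c'" if "c \<in> C" "c' \<in> C" "c \<noteq> c'" for c c'
      using sep[OF that] lipschitz[of c c'] by fastforce
    show "\<not> (E c u \<and> E c' u)" if "c \<in> C" "c' \<in> C" "c \<noteq> c'" for c c' u
      using sep[OF that] lipschitz[of c u] lipschitz[of c' u] by fastforce
  qed
qed

lemma regular_mod_piece_0:
  assumes "L \<in> products 0" "T \<subseteq> products 0 - {L}"
  shows "regular_mod (\<lambda>i. esym V (Suc i) :: ('v, 'k::comm_ring_1) mpoly) s (piece 0 T L)"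
proof (rule regular_mod_piece_cover)
  fix S assume "S \<subseteq> nbs L"
  moreover have "nbs L = {}" using assms by (simp add: nbs_def)
  ultimately show "\<exists>a b. \<forall>v. v \<in> nbs L \<or> (\<exists>u\<in>S. {#u, u#} \<in> piece 0 T L \<and> E v u) \<longrightarrow>
      \<Phi> v \<in> {a..a+3} \<union> {b..b+3}"
    by auto
qed (use assms in auto)

text \<open>An edge spans at most two values of \<Phi>, its neighbours four, and their neighbours
  six. Two overlapping windows cover six consecutive values.\<close>

lemma regular_mod_piece_1:
  assumes L: "L \<in> products 1" and T: "T \<subseteq> products 1 - {L}"
  shows "regular_mod (\<lambda>i. esym V (Suc i) :: ('v, 'k::comm_ring_1) mpoly) s (piece 1 T L)"
proof (rule regular_mod_piece_cover[OF L])
  obtain x y where xy: "L = {#x, y#}" "E x y" using L by auto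
  define m where "m = min (\<Phi> x) (\<Phi> y)"
  have xy': "\<Phi> x \<in> {m..m+1}" "\<Phi> y \<in> {m..m+1}"
    using lipschitz[OF xy(2)] by (auto simp: m_def)
  have nb: "\<Phi> v \<in> {m-1..m+2}" if "v \<in> nbs L" for v
    using that xy' lipschitz[of v x] lipschitz[of v y] by (auto simp: nbs_def xy(1) abs_le_iff)
  have nb2: "\<Phi> v \<in> {m-2..m+3}" if "E v u" "u \<in> nbs L" for u v
    using nb[OF that(2)] lipschitz[OF that(1)] by (auto simp: abs_le_iff)
  fix S assume S: "S \<subseteq> nbs L"
  have "\<Phi> v \<in> {m-2..m-2+3} \<union> {m..m+3}"
    if v: "v \<in> nbs L \<or> (\<exists>u\<in>S. {#u, u#} \<in> piece 1 T L \<and> E v u)" for v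
  proof -
    have "\<Phi> v \<in> {m-2..m+3}"
      using v
    proof
      assume "v \<in> nbs L"
      then show ?thesis using nb[of v] by auto
    next
      assume "\<exists>u\<in>S. {#u, u#} \<in> piece 1 T L \<and> E v u"
      then show ?thesis using nb2 S by blast
    qed
    then show ?thesis by auto
  qed
  then show "\<exists>a b. \<forall>v. v \<in> nbs L \<or> (\<exists>u\<in>S. {#u, u#} \<in> piece 1 T L \<and> E v u) \<longrightarrow>
      \<Phi> v \<in> {a..a+3} \<union> {b..b+3}"
    by blast
qed (use T in auto)

text \<open>The window starts one below the minimum of \<Phi> on A and ends one above the largest
  possible value. For a triangle, k = 1, it has exactly four values.\<close>

lemma cluster:
  assumes "\<And>u u'. u \<in> A \<Longrightarrow> u' \<in> A \<Longrightarrow> \<bar>\<Phi> u - \<Phi> u'\<bar> \<le> k" "A \<noteq> {}" "A \<subseteq> V"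
  obtains m where "\<And>u v. u \<in> A \<Longrightarrow> E v u \<Longrightarrow> \<Phi> v \<in> {m..m+k+2}"
proof -
  have fin: "finite A" using assms(3) finite_V finite_subset by blast
  obtain u0 where u0: "u0 \<in> A" "\<Phi> u0 = Min (\<Phi> ` A)"
    using Min_in[of "\<Phi> ` A"] fin assms(2) by fastforce
  have "\<Phi> v \<in> {\<Phi> u0 - 1..\<Phi> u0 - 1 + k + 2}" if "u \<in> A" "E v u" for u v
  proof -
    have "\<Phi> u0 \<le> \<Phi> u" using u0(2) fin that(1) by simp
    then show ?thesis using assms(1)[OF that(1) u0(1)] lipschitz[OF that(2)] by auto
  qed
  then show ?thesis using that by blast
qed

text \<open>If some divided-out vertex closes a walk of length five with L, it is the only one with
  its square in the piece, and everything to avoid lies within three of its value. Otherwise each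
  such vertex is the apex of a triangle on an edge of L, each edge has at most one apex, and each
  edge needs one window.\<close>

lemma regular_mod_piece_2:
  fixes wt :: "'v \<Rightarrow> nat"
  assumes wt: "inj_on wt V" and L: "L \<in> products 2"
    and T: "T \<subseteq> products 2 - {L}" "{M \<in> products 2. (\<Sum>v\<in>#M. wt v) < (\<Sum>v\<in>#L. wt v)} \<subseteq> T"
      "\<forall>M\<in>T. (\<Sum>v\<in>#M. wt v) \<le> (\<Sum>v\<in>#L. wt v)"
  shows "regular_mod (\<lambda>i. esym V (Suc i) :: ('v, 'k::comm_ring_1) mpoly) s (piece 2 T L)"
proof (rule regular_mod_piece_cover[OF L])
  obtain a b c d where abcd: "L = {#a, b, c, d#}" "E a b" "E c d"
    using L by (auto simp: numeral_2_eq_2)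
  let ?J = "piece 2 T L"
  fix S assume S: "S \<subseteq> nbs L" "mset_set S \<notin> ?J"
  have "S \<subseteq> V" using S(1) nbs_V by blast
  then have SV: "S \<subseteq> V" "finite S" using finite_subset[OF _ finite_V] by simp_all
  have LV: "a \<in> V" "b \<in> V" "c \<in> V" "d \<in> V" using abcd(2,3) E_V E_sym by blast+
  have single: "{#u#} \<notin> ?J" if "u \<in> S" for u
  proof
    assume "{#u#} \<in> ?J"
    moreover have "{#u#} \<subseteq># mset_set S" using that SV by simp
    ultimately show False using upsetD[OF upset_piece] S(2) by blast
  qed
  \<comment> \<open>S survives in the quotient, so L times two distinct members of S contains no
    product of three edges. This limits the vertices with squares in the piece.\<close>
  have pair: "A \<notin> products 3" if "u \<in> S" "u' \<in> S" "u \<noteq> u'" "A = L + {#u, u'#}" for u u' A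
  proof
    assume "A \<in> products 3"
    then have "{#u, u'#} \<in> ?J" using pieceI[of A 2 T L "{#u, u'#}"] that(4) by simp
    moreover have "{#u, u'#} \<subseteq># mset_set S" using that SV by (simp add: pair_subset_mset)
    ultimately show False using upsetD[OF upset_piece] S(2) by blast
  qed
  define S2 where "S2 = {u \<in> S. {#u, u#} \<in> ?J}"
  have types: "E u a \<and> E u b \<or> E u c \<and> E u d \<or>
    (\<exists>a1 a2 c1 c2. {#a1, a2#} = {#a, b#} \<and> {#c1, c2#} = {#c, d#} \<and> E u a1 \<and> E u c1 \<and> E a2 c2)"
    if "u \<in> S2" for u
    by (rule piece_two_odd_walk[OF wt abcd T]) (use that SV(1) single in \<open>auto simp: S2_def\<close>)
  have nbsL: "nbs L = {v. E v a \<or> E v b \<or> E v c \<or> E v d}"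
    by (auto simp: nbs_def abcd(1))
  have "\<exists>l r. \<forall>v. v \<in> nbs L \<or> (\<exists>u\<in>S2. E v u) \<longrightarrow> \<Phi> v \<in> {l..l+3} \<union> {r..r+3}"
  proof (cases "\<exists>u\<in>S2. \<exists>a1 a2 c1 c2. {#a1, a2#} = {#a, b#} \<and> {#c1, c2#} = {#c, d#} \<and>
      E u a1 \<and> E u c1 \<and> E a2 c2")
    case True
    then obtain u a1 a2 c1 c2 where u: "u \<in> S2" and ac: "{#a1, a2#} = {#a, b#}" "{#c1, c2#} = {#c, d#}"
      and E5: "E u a1" "E u c1" "E a2 c2" by blast
    have E2: "E a1 a2" "E c1 c2" using ac abcd(2,3) E_sym by (auto simp: pair_mset_eq)
    have L': "L = {#a1, a2, c1, c2#}"
    proof -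
      have "{#a1, a2#} + {#c1, c2#} = {#a, b#} + {#c, d#}" using ac by simp
      then show ?thesis using abcd(1) by (simp add: add_mset_commute)
    qed
    \<comment> \<open>Any other u' is adjacent to one of the four vertices of the walk besides u.
      Deleting that vertex leaves a path on four vertices, which splits into two edges; with the
      edge at u' there are three edges in L u u'.\<close>
    have "S2 \<subseteq> {u}"
    proof
      fix u' assume u': "u' \<in> S2"
      show "u' \<in> {u}"
      proof (rule ccontr)
        assume "u' \<notin> {u}"
        then have no: "A \<notin> products 3" if "A = L + {#u, u'#}" for A
          using pair[of u u' A] u u' that by (auto simp: S2_def)
        have "u' \<in> nbs L" using u' S(1) by (auto simp: S2_def)
        then have "E u' a1 \<or> E u' a2 \<or> E u' c1 \<or> E u' c2"
          using ac by (auto simp: nbsL pair_mset_eq)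
        then consider "E u' a1" | "E u' a2" | "E u' c1" | "E u' c2" by blast
        then show False
        proof cases
          case 1
          then have "{#u', a1, a2, c2, u, c1#} \<in> products 3" using E5 by (intro products_3)
          then show False using no L' by (auto simp: add_mset_commute)
        next
          case 2
          then have "{#u', a2, u, a1, c1, c2#} \<in> products 3" using E5 E2 by (intro products_3)
          then show False using no L' by (auto simp: add_mset_commute)
        next
          case 3
          then have "{#u', c1, a2, c2, u, a1#} \<in> products 3" using E5 by (intro products_3)
          then show False using no L' by (auto simp: add_mset_commute)
        next
          case 4
          then have "{#u', c2, u, c1, a1, a2#} \<in> products 3" using E5 E2 by (intro products_3)
          then show False using no L' by (auto simp: add_mset_commute)
        qed
      qed
    qed
    have "\<bar>\<Phi> a1 - \<Phi> u\<bar> \<le> 2" "\<bar>\<Phi> c1 - \<Phi> u\<bar> \<le> 2"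
      using lipschitz[OF E5(1)] lipschitz[OF E5(2)] by linarith+
    moreover have "\<bar>\<Phi> a2 - \<Phi> u\<bar> \<le> 2"
      using lipschitz[OF E5(1)] lipschitz[OF E2(1)] by linarith
    moreover have "\<bar>\<Phi> c2 - \<Phi> u\<bar> \<le> 2"
      using lipschitz[OF E5(2)] lipschitz[OF E2(2)] by linarith
    ultimately have near: "\<bar>\<Phi> w - \<Phi> u\<bar> \<le> 2" if "w \<in> {u, a1, a2, c1, c2}" for w
      using that by (elim insertE emptyE) simp_all
    \<comment> \<open>Seven consecutive values, covered by two windows sharing the middle
      one.\<close>
    have "\<Phi> v \<in> {\<Phi> u - 3..\<Phi> u - 3 + 3} \<union> {\<Phi> u..\<Phi> u + 3}"
      if v: "v \<in> nbs L \<or> (\<exists>u\<in>S2. E v u)" for v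
    proof -
      have "\<exists>w\<in>{u, a1, a2, c1, c2}. E v w"
        using v \<open>S2 \<subseteq> {u}\<close> ac by (auto simp: nbsL pair_mset_eq)
      then obtain w where w: "w \<in> {u, a1, a2, c1, c2}" "E v w" by blast
      have "\<bar>\<Phi> v - \<Phi> u\<bar> \<le> 3" using near[OF w(1)] lipschitz[OF w(2)] by linarith
      then show ?thesis by auto
    qed
    then show ?thesis by blast
  next
    case False
    have half: "\<exists>m. \<forall>v. E v x \<or> E v y \<or> (\<exists>u\<in>S2. E u x \<and> E u y \<and> E v u) \<longrightarrow> \<Phi> v \<in> {m..m+3}"
      if xy: "E x y" "E z w" "L = {#x, y, z, w#}" for x y z w
    proof -
      let ?A = "{x, y} \<union> {u \<in> S2. E u x \<and> E u y}"
      \<comment> \<open>Two apexes u and u' over xy give the three edges \<open>u x\<close>,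
        \<open>u' y\<close>, \<open>z w\<close> inside L u u'.\<close>
      have one: "u = u'" if "u \<in> S2" "E u x" "E u y" "u' \<in> S2" "E u' x" "E u' y" for u u'
      proof (rule ccontr)
        assume "u \<noteq> u'"
        moreover have "{#u, x, u', y, z, w#} \<in> products 3" using that xy by (intro products_3)
        ultimately show False
          using pair[of u u' "{#u, x, u', y, z, w#}"] that xy(3) by (auto simp: S2_def add_mset_commute)
      qed
      have diam: "\<bar>\<Phi> v - \<Phi> v'\<bar> \<le> 1" if "v \<in> ?A" "v' \<in> ?A" for v v'
      proof -
        have "v = v' \<or> E v v'" using that one xy(1) E_sym by blast
        then show ?thesis using lipschitz by auto
      qed
      have "?A \<subseteq> V" using SV(1) E_V[OF xy(1)] E_V[OF E_sym[OF xy(1)]] by (auto simp: S2_def)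
      then obtain m where m: "\<And>u v. u \<in> ?A \<Longrightarrow> E v u \<Longrightarrow> \<Phi> v \<in> {m..m+1+2}"
        using cluster[of ?A 1, OF diam] by auto
      have "\<Phi> v \<in> {m..m+3}" if "u \<in> ?A" "E v u" for u v using m[OF that] by simp
      then show ?thesis by blast
    qed
    have L2: "L = {#c, d, a, b#}" using abcd(1) by (simp add: add_mset_commute)
    obtain l where l: "\<And>v. E v a \<or> E v b \<or> (\<exists>u\<in>S2. E u a \<and> E u b \<and> E v u) \<Longrightarrow> \<Phi> v \<in> {l..l+3}"
      using half[OF abcd(2,3,1)] by blast
    obtain r where r: "\<And>v. E v c \<or> E v d \<or> (\<exists>u\<in>S2. E u c \<and> E u d \<and> E v u) \<Longrightarrow> \<Phi> v \<in> {r..r+3}"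
      using half[OF abcd(3,2) L2] by blast
    have "E u a \<and> E u b \<or> E u c \<and> E u d" if "u \<in> S2" for u
      using types[OF that] False that by blast
    then have "\<Phi> v \<in> {l..l+3} \<union> {r..r+3}" if "v \<in> nbs L \<or> (\<exists>u\<in>S2. E v u)" for v
      using that l[of v] r[of v] unfolding nbsL by blast
    then show ?thesis by blast
  qed
  moreover have "(\<exists>u\<in>S2. E v u) \<longleftrightarrow> (\<exists>u\<in>S. {#u, u#} \<in> ?J \<and> E v u)" for v
    by (auto simp: S2_def)
  ultimately show "\<exists>l r. \<forall>v. v \<in> nbs L \<or> (\<exists>u\<in>S. {#u, u#} \<in> ?J \<and> E v u) \<longrightarrow>
      \<Phi> v \<in> {l..l+3} \<union> {r..r+3}"
    by (simp only:)
qed (use T in auto)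

section \<open>Assembling the filtration of the third power\<close>

lemma finite_products: "finite (products n)"
proof (induction n)
  case (Suc n)
  have "products (Suc n) \<subseteq> (\<lambda>(u, v, M). {#u, v#} + M) ` (V \<times> V \<times> products n)"
  proof
    fix M assume "M \<in> products (Suc n)"
    then obtain u v P where M: "M = {#u, v#} + P" "E u v" "P \<in> products n" by auto
    then have "(u, v, P) \<in> V \<times> V \<times> products n" using E_V[OF M(2)] E_V[OF E_sym[OF M(2)]] by simp
    then show "M \<in> (\<lambda>(u, v, M). {#u, v#} + M) ` (V \<times> V \<times> products n)"
      by (rule rev_image_eqI) (simp add: M(1))
  qed
  then show ?case using Suc finite_V by (meson finite_SigmaI finite_imageI finite_subset)
qed simp

lemma power_set_Suc_Un: "power_set (Suc n) \<union> multiples (products n) = power_set n"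
proof -
  have "M \<in> multiples (products n)" if M: "M \<in> multiples (products (Suc n))" for M
  proof -
    obtain L where "L \<in> products (Suc n)" "L \<subseteq># M" using M unfolding multiples_def by blast
    then obtain u v P where "P \<in> products n" "{#u, v#} + P \<subseteq># M" by auto
    then show ?thesis
      using subset_mset.order_trans[OF mset_subset_eq_add_right] by (fastforce simp: multiples_def)
  qed
  then show ?thesis by (auto simp: power_set_def)
qed

lemma regular_mod_power_set_Suc:
  fixes wt :: "'v multiset \<Rightarrow> nat"
  assumes "regular_mod g t (power_set n)"
    and "\<And>L T. L \<in> products n \<Longrightarrow> T \<subseteq> products n - {L} \<Longrightarrow> {M \<in> products n. wt M < wt L} \<subseteq> T \<Longrightarrow>
      \<forall>M\<in>T. wt M \<le> wt L \<Longrightarrow> regular_mod g t (piece n T L)"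
  shows "regular_mod g t (power_set (Suc n))"
proof (rule regular_mod_filtration[OF finite_products upset_power_set])
  show "regular_mod g t (power_set (Suc n) \<union> multiples (products n))"
    using assms(1) by (simp only: power_set_Suc_Un)
  fix L T
  assume "L \<in> products n" "T \<subseteq> products n - {L}" "{M \<in> products n. wt M < wt L} \<subseteq> T"
    "\<forall>M\<in>T. wt M \<le> wt L"
  then show "regular_mod g t (colon (power_set (Suc n) \<union> multiples T) L)"
    unfolding piece_def[symmetric] by (rule assms(2))
qed

lemma regular_mod_power_set_3:
  "regular_mod (\<lambda>i. esym V (Suc i) :: ('v, 'k::comm_ring_1) mpoly) s (power_set 3)"
proof -
  let ?g = "\<lambda>i. esym V (Suc i) :: ('v, 'k) mpoly"
  obtain wt :: "'v \<Rightarrow> nat" where wt: "inj_on wt V"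
    using finite_imp_inj_to_nat_seg[OF finite_V] by blast
  let ?w = "\<lambda>M. \<Sum>v\<in>#M. wt v"
  have "{#} \<in> power_set 0" by (simp add: power_set_def multiples_def)
  then have "regular_mod ?g s (power_set 0)" by (rule regular_mod_empty_mset[OF upset_power_set])
  then have "regular_mod ?g s (power_set (Suc 0))"
    by (rule regular_mod_power_set_Suc[where wt = ?w]) (rule regular_mod_piece_0)
  then have "regular_mod ?g s (power_set (Suc 1))"
    unfolding One_nat_def[symmetric]
    by (rule regular_mod_power_set_Suc[where wt = ?w]) (rule regular_mod_piece_1)
  then have "regular_mod ?g s (power_set 2)" by (simp only: Suc_1)
  then have "regular_mod ?g s (power_set (Suc 2))"
    by (rule regular_mod_power_set_Suc[where wt = ?w]) (rule regular_mod_piece_2[OF wt])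
  then show ?thesis by (simp only: eval_nat_numeral)
qed

end

section \<open>Distances in graphs\<close>

text \<open>Greedy choice: the minimum is kept, at most two further values are discarded with it,
  and the rest is at distance at least three.\<close>

lemma separated_subset:
  fixes X :: "int set"
  assumes "finite X"
  shows "\<exists>Y\<subseteq>X. card X \<le> 3 * card Y \<and> (\<forall>y\<in>Y. \<forall>y'\<in>Y. y \<noteq> y' \<longrightarrow> 3 \<le> \<bar>y - y'\<bar>)"
  using assms
proof (induction X rule: finite_psubset_induct)
  case (psubset X)
  show ?case
  proof (cases "X = {}")
    case False
    define m where "m = Min X"
    have m: "m \<in> X" "\<And>x. x \<in> X \<Longrightarrow> m \<le> x"
      using psubset.hyps False by (auto simp: m_def)
    let ?X = "X - {m..m+2}"
    have "m \<in> {m..m+2}" by simp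
    then have "?X \<subset> X" using m(1) by blast
    from psubset.IH[OF this] obtain Y where Y: "Y \<subseteq> ?X" "card ?X \<le> 3 * card Y"
      "\<forall>y\<in>Y. \<forall>y'\<in>Y. y \<noteq> y' \<longrightarrow> 3 \<le> \<bar>y - y'\<bar>"
      by (elim exE conjE)
    have fin: "finite Y" using Y(1) psubset.hyps finite_subset by blast
    have far: "3 \<le> y - m" if "y \<in> Y" for y
    proof -
      have "y \<in> X" "y \<notin> {m..m+2}" using that Y(1) by auto
      then show ?thesis using m(2)[of y] by auto
    qed
    have "m \<notin> Y" using far[of m] by auto
    then have card: "card (insert m Y) = Suc (card Y)" using fin by simp
    have "card X \<le> card ?X + card {m..m+2}"
      using diff_card_le_card_Diff[of "{m..m+2}" X] by simp
    then have "card X \<le> 3 * card (insert m Y)" using Y(2) card by simp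
    moreover have "insert m Y \<subseteq> X" using Y(1) m(1) by auto
    moreover have "\<forall>y\<in>insert m Y. \<forall>y'\<in>insert m Y. y \<noteq> y' \<longrightarrow> 3 \<le> \<bar>y - y'\<bar>"
      using Y(3) far by force
    ultimately show ?thesis by blast
  qed simp
qed

text \<open>
  The numbers \<open>d + 10 * (1 + int (f z))\<close> stand for the components other than a diametral one.  Each
  of them weighs as much as three points of a shortest path.
\<close>

lemma interval_weight:
  fixes f :: "'a \<Rightarrow> nat" and a d :: int
  assumes "finite Z" "inj_on f Z"
  shows "card ({0..d} \<inter> {a..a+3}) + 3 * card {z\<in>Z. d + 10 * (1 + int (f z)) \<in> {a..a+3}} \<le> 4"
proof (cases "{z\<in>Z. d + 10 * (1 + int (f z)) \<in> {a..a+3}} = {}")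
  case True
  have "card ({0..d} \<inter> {a..a+3}) \<le> card {a..a+3}" by (intro card_mono) auto
  then show ?thesis unfolding True by simp
next
  case False
  then obtain z where z: "z \<in> Z" "d + 10 * (1 + int (f z)) \<in> {a..a+3}" by blast
  \<comment> \<open>A window containing such a number begins at d + 7 or later. Distinct numbers of
    this kind differ by at least ten, so the window holds only one.\<close>
  then have "{0..d} \<inter> {a..a+3} = {}" by auto
  moreover have "{z\<in>Z. d + 10 * (1 + int (f z)) \<in> {a..a+3}} \<subseteq> {z}"
  proof
    fix z' assume z': "z' \<in> {z\<in>Z. d + 10 * (1 + int (f z)) \<in> {a..a+3}}"
    then have "f z = f z'" using z by auto
    then show "z' \<in> {z}" using inj_onD[OF assms(2)] z z' by auto
  qed
  then have "card {z\<in>Z. d + 10 * (1 + int (f z)) \<in> {a..a+3}} \<le> 1"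
    using card_mono[of "{z}"] by fastforce
  ultimately show ?thesis by simp
qed

text \<open>Count the d + 1 path values once and each other component three times. By
  \<open>interval_weight\<close> two windows remove at most 8 from this total, and a third of the
  remainder can be chosen.\<close>

lemma separated_values:
  fixes \<Phi> :: "'v \<Rightarrow> int" and f :: "'a \<Rightarrow> nat" and d s :: nat
  assumes Z: "finite Z" "inj_on f Z"
    and d: "\<And>n. n \<le> d \<Longrightarrow> int n \<in> \<Phi> ` V"
    and c: "\<And>z. z \<in> Z \<Longrightarrow> int d + 10 * (1 + int (f z)) \<in> \<Phi> ` V"
    and s: "3 * int s \<le> int d - 5 + 3 * int (card Z)"
  shows "\<exists>C\<subseteq>V. s \<le> card C \<and> (\<forall>c\<in>C. \<Phi> c \<notin> {a..a+3} \<union> {b..b+3})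
      \<and> (\<forall>c\<in>C. \<forall>c'\<in>C. c \<noteq> c' \<longrightarrow> 3 \<le> \<bar>\<Phi> c - \<Phi> c'\<bar>)"
proof -
  define r where "r z = int d + 10 * (1 + int (f z))" for z
  let ?I = "{a..a+3} \<union> {b..b+3}"
  obtain Y where Y: "Y \<subseteq> {0..int d} - ?I" "card ({0..int d} - ?I) \<le> 3 * card Y"
    "\<forall>y\<in>Y. \<forall>y'\<in>Y. y \<noteq> y' \<longrightarrow> 3 \<le> \<bar>y - y'\<bar>"
    using separated_subset[of "{0..int d} - ?I"] by auto
  let ?Z = "{z\<in>Z. r z \<notin> ?I}"
  let ?Z1 = "{z\<in>Z. r z \<in> {a..a+3}}" and ?Z2 = "{z\<in>Z. r z \<in> {b..b+3}}"
  let ?D = "{0..int d}"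
  have finY: "finite Y" using Y(1) finite_subset by blast
  have cD: "card ?D \<le> card (?D - ?I) + card (?D \<inter> {a..a+3}) + card (?D \<inter> {b..b+3})"
  proof -
    have "?D = (?D - ?I) \<union> ((?D \<inter> {a..a+3}) \<union> (?D \<inter> {b..b+3}))" by blast
    then have "card ?D = card ((?D - ?I) \<union> ((?D \<inter> {a..a+3}) \<union> (?D \<inter> {b..b+3})))"
      by (rule arg_cong)
    then show ?thesis
      using card_Un_le[of "?D - ?I" "(?D \<inter> {a..a+3}) \<union> (?D \<inter> {b..b+3})"]
        card_Un_le[of "?D \<inter> {a..a+3}" "?D \<inter> {b..b+3}"] by linarith
  qed
  have cZ: "card Z \<le> card ?Z + card ?Z1 + card ?Z2"
  proof -
    have "Z = ?Z \<union> (?Z1 \<union> ?Z2)" by blast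
    then have "card Z = card (?Z \<union> (?Z1 \<union> ?Z2))" by (rule arg_cong)
    then show ?thesis
      using card_Un_le[of ?Z "?Z1 \<union> ?Z2"] card_Un_le[of ?Z1 ?Z2] by linarith
  qed
  have c4: "card (?D \<inter> {a..a+3}) + 3 * card ?Z1 \<le> 4" "card (?D \<inter> {b..b+3}) + 3 * card ?Z2 \<le> 4"
    unfolding r_def by (rule interval_weight[OF Z])+
  have "card ?D = d + 1" "3 * s + 5 \<le> d + 3 * card Z" using s by simp_all
  \<comment> \<open>The count gives three times the right side \<ge> d + 1 - 8 + 3
    \<open>card Z\<close> \<ge> 3 s - 2, and integrality absorbs the 2.\<close>
  then have "s \<le> card Y + card ?Z" using cD cZ c4 Y(2) by linarith
  have inj_r: "inj_on r ?Z" using Z(2) by (auto simp: inj_on_def r_def)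
  have sep_r: "3 \<le> \<bar>r z - r z'\<bar>" if "z \<in> Z" "z' \<in> Z" "r z \<noteq> r z'" for z z'
    using that by (auto simp: r_def)
  have sep_Yr: "3 \<le> \<bar>y - r z\<bar>" if "y \<in> Y" for y z
  proof -
    have "y \<le> int d" using that Y(1) by auto
    then show ?thesis by (simp add: r_def)
  qed
  let ?W = "Y \<union> r ` ?Z"
  have "Y \<inter> r ` ?Z = {}"
  proof (rule equals0I)
    fix y assume "y \<in> Y \<inter> r ` ?Z"
    then obtain z where "y \<in> Y" "y = r z" by blast
    then show False using sep_Yr[of y z] by simp
  qed
  then have cardW: "card ?W = card Y + card ?Z"
    using finY Z(1) inj_r by (simp add: card_Un_disjoint card_image)
  have WV: "?W \<subseteq> \<Phi> ` V"
  proof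
    fix w assume "w \<in> ?W"
    then consider "w \<in> Y" | z where "z \<in> Z" "w = r z" by blast
    then show "w \<in> \<Phi> ` V"
    proof cases
      case 1
      then have "0 \<le> w" "w \<le> int d" using Y(1) by auto
      then show ?thesis using d[of "nat w"] by simp
    qed (use c in \<open>auto simp: r_def\<close>)
  qed
  have W_avoid: "w \<notin> ?I" if "w \<in> ?W" for w using that Y(1) by auto
  have W_sep: "3 \<le> \<bar>w - w'\<bar>" if "w \<in> ?W" "w' \<in> ?W" "w \<noteq> w'" for w w'
  proof -
    consider "w \<in> Y" "w' \<in> Y" | z where "w \<in> Y" "w' = r z" | z where "w' \<in> Y" "w = r z"
      | z z' where "z \<in> Z" "z' \<in> Z" "w = r z" "w' = r z'" using \<open>w \<in> ?W\<close> \<open>w' \<in> ?W\<close> by blast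
    then show ?thesis
    proof cases
      case 1 then show ?thesis using Y(3) that(3) by blast
    next
      case 2 then show ?thesis using sep_Yr by blast
    next
      case 3 then show ?thesis using sep_Yr[OF 3(1)] by (simp add: abs_minus_commute)
    next
      case 4 then show ?thesis using sep_r that(3) by blast
    qed
  qed
  obtain C where C: "C \<subseteq> V" "inj_on \<Phi> C" "\<Phi> ` C = ?W"
    using WV unfolding subset_image_inj by (elim exE conjE) simp
  have "card C = card ?W" using card_image[OF C(2)] C(3) by simp
  show ?thesis
  proof (intro exI[of _ C] conjI ballI impI)
    show "s \<le> card C" using \<open>card C = card ?W\<close> cardW \<open>s \<le> card Y + card ?Z\<close> by simp
    show "\<Phi> c \<notin> ?I" if "c \<in> C" for c using W_avoid C(3) that by blast
    show "3 \<le> \<bar>\<Phi> c - \<Phi> c'\<bar>" if "c \<in> C" "c' \<in> C" "c \<noteq> c'" for c c'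
    proof (rule W_sep)
      show "\<Phi> c \<noteq> \<Phi> c'" using inj_onD[OF C(2), of c c'] that by blast
    qed (use C(3) that in blast)+
  qed (rule C(1))
qed

section \<open>Distances along walks and paths\<close>

lemma (in wf_digraph) awalk_imp_apath_le:
  assumes "awalk u p v"
  shows "\<exists>q. apath u q v \<and> length q \<le> length p"
  using assms
proof (induction rule: awalk_to_apath_induct)
  case (path p)
  then show ?case by (auto simp: apath_def)
next
  case (decomp p q r s)
  have "p = q @ r @ s" using awalk_cyc_decomp_has_prop[OF decomp(1,3)] decomp(2) by simp
  then show ?case using decomp(4) by auto
qed

text \<open>Removing cycles never lengthens a walk, so the minimum over simple paths bounds walks as
  well. This is needed when an arc is appended to a shortest path, since the result may repeat a
  vertex.\<close>

lemma path_dist_le: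
  assumes "wf_digraph H" "pre_digraph.awalk H u p v"
  shows "path_dist H u v \<le> length p"
proof -
  interpret wf_digraph H by fact
  obtain q where q: "apath u q v" "length q \<le> length p"
    using awalk_imp_apath_le[OF assms(2)] by blast
  have "path_dist H u v \<le> length q"
    unfolding path_dist_def by (rule Least_le) (use q(1) in blast)
  then show ?thesis using q(2) by simp
qed

lemma path_dist_awalk:
  assumes "wf_digraph H" "u \<rightarrow>\<^sup>*\<^bsub>H\<^esub> v"
  obtains p where "pre_digraph.awalk H u p v" "length p = path_dist H u v"
proof -
  interpret wf_digraph H by fact
  have "\<exists>n p. apath u p v \<and> length p = n" using assms(2) reachable_apath by blast
  then have "\<exists>p. apath u p v \<and> length p = path_dist H u v"
    unfolding path_dist_def by (rule LeastI_ex)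
  then show ?thesis using that by (blast intro: awalkI_apath)
qed

lemma path_dist_step:
  assumes "wf_digraph H" "u \<rightarrow>\<^sup>*\<^bsub>H\<^esub> v" "v \<rightarrow>\<^bsub>H\<^esub> w"
  shows "path_dist H u w \<le> Suc (path_dist H u v)"
proof -
  interpret wf_digraph H by fact
  obtain p where p: "awalk u p v" "length p = path_dist H u v"
    using path_dist_awalk[OF assms(1,2)] by blast
  obtain e where e: "e \<in> arcs H" "tail H e = v" "head H e = w"
    using assms(3) by auto
  have "awalk u (p @ [e]) w"
    using awalk_appendI[OF p(1)] arc_implies_awalk[OF e(1)] e by simp
  from path_dist_le[OF assms(1) this] show ?thesis using p(2) by simp
qed

lemma path_dist_self: "wf_digraph H \<Longrightarrow> u \<in> verts H \<Longrightarrow> path_dist H u u = 0"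
  using path_dist_le[of H u "[]" u] by (simp add: pre_digraph.awalk_def pre_digraph.cas.simps)

text \<open>A discrete intermediate value argument: the distance starts at 0 and rises by at most
  one per arc on the way to v.\<close>

lemma path_dist_values:
  assumes "wf_digraph H" "u \<rightarrow>\<^sup>*\<^bsub>H\<^esub> v" "n \<le> path_dist H u v"
  shows "\<exists>w\<in>verts H. u \<rightarrow>\<^sup>*\<^bsub>H\<^esub> w \<and> path_dist H u w = n"
proof -
  interpret wf_digraph H by fact
  show ?thesis using assms(2,3)
  proof (induction rule: reachable_induct)
    case base
    then show ?case using path_dist_self[OF assms(1)] by (intro bexI[of _ u]) auto
  next
    case (step x y)
    have "y \<in> verts H" using step.hyps by auto
    moreover have "u \<rightarrow>\<^sup>*\<^bsub>H\<^esub> y" using step.hyps by (rule reachable_adj_trans)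
    moreover have "path_dist H u y \<le> Suc (path_dist H u x)"
      by (rule path_dist_step[OF assms(1) step.hyps])
    moreover have "n = path_dist H u y" if "\<not> n \<le> path_dist H u x"
      using that step.prems calculation(3) by simp
    ultimately show ?case using step.IH by blast
  qed
qed

lemma induced_subgraph_dominates:
  assumes "induced_subgraph H G" "u \<in> verts H" "v \<in> verts H"
  shows "u \<rightarrow>\<^bsub>H\<^esub> v \<longleftrightarrow> u \<rightarrow>\<^bsub>G\<^esub> v"
proof -
  have c: "tail H = tail G" "head H = head G"
    using assms(1) by (auto simp: induced_subgraph_def subgraph_def compatible_def)
  show ?thesis
    using assms by (auto simp: arcs_ends_conv c induced_subgraph_def image_iff)
qed

text \<open>
  The potential is the distance from an end point of a diametral pair on one component and a
  constant on each of the others, the constants being far apart.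
\<close>

lemma graph_potential:
  fixes G :: "('v, 'e) pre_digraph" and s :: nat
  assumes "graph G" "verts G \<noteq> {}"
    and s: "int s \<le> \<lceil>(real (graph_diameter G) - 7) / 3\<rceil> + int (card (pre_digraph.sccs G)) - 1"
  obtains \<Phi> where "lipschitz_graph (verts G) (dominates G) \<Phi> s"
proof -
  interpret graph G by fact
  have sym: "sym (arcs_ends G)" using sym_arcs by (simp add: symmetric_def)
  have simple: "simple_graph (verts G) (dominates G)"
  proof
    show "finite (verts G)" by simp
    show "v \<rightarrow>\<^bsub>G\<^esub> u" if "u \<rightarrow>\<^bsub>G\<^esub> v" for u v using symD[OF sym] that .
    show "\<not> u \<rightarrow>\<^bsub>G\<^esub> u" for u using no_loops by (auto simp: arcs_ends_conv)
    show "u \<in> verts G" if "u \<rightarrow>\<^bsub>G\<^esub> v" for u v using that by (rule adj_in_verts)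
  qed
  let ?d = "graph_diameter G"
  have fin_sccs: "finite sccs" by (simp add: sccs_conv_sccs_verts finite_sccs_verts)
  obtain x0 where "x0 \<in> verts G" using assms(2) by blast
  then have "sccs \<noteq> {}" using induce_reachable_is_in_sccs by blast
  then obtain H where H: "H \<in> sccs" "connected_diameter H = ?d"
    using Max_in[of "connected_diameter ` sccs"] fin_sccs unfolding graph_diameter_def[symmetric]
    by (metis (no_types, lifting) finite_imageI image_iff image_is_empty)
  have ind: "induced_subgraph H G" and conn: "strongly_connected H" using H(1) by (auto simp: sccs_def)
  have wfH: "wf_digraph H" using ind by (auto simp: induced_subgraph_def subgraph_def)
  have VH: "verts H \<subseteq> verts G" using ind by (auto simp: induced_subgraph_def subgraph_def)
  then have finH: "finite (verts H)" using finite_verts by (rule finite_subset)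
  let ?P = "{path_dist H u v | u v. u \<in> verts H \<and> v \<in> verts H}"
  have "?P = (\<lambda>(u, v). path_dist H u v) ` (verts H \<times> verts H)" by auto
  then have "finite ?P" using finH by simp
  moreover obtain y where "y \<in> verts H" using conn by (auto simp: strongly_connected_def)
  then have "?P \<noteq> {}" by blast
  ultimately have "connected_diameter H \<in> ?P" unfolding connected_diameter_def by (rule Max_in)
  then obtain u v where uv: "u \<in> verts H" "v \<in> verts H" "path_dist H u v = ?d"
    using H(2) by auto
  have reach: "u \<rightarrow>\<^sup>*\<^bsub>H\<^esub> x" if "x \<in> verts H" for x
    using conn uv(1) that by (auto simp: strongly_connected_def)
  define Z where "Z = sccs_verts - {verts H}"
  have HS: "verts H \<in> sccs_verts" using H(1) by (simp add: sccs_verts_conv)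
  have finZ: "finite Z" by (simp add: Z_def finite_sccs_verts)
  have cardZ: "int (card Z) = int (card sccs) - 1"
  proof -
    have "0 < card sccs_verts" using HS finite_sccs_verts card_gt_0_iff by blast
    then show ?thesis unfolding Z_def using HS finite_sccs_verts by (simp add: card_sccs_verts of_nat_diff)
  qed
  obtain f :: "'v set \<Rightarrow> nat" where f: "inj_on f Z"
    using finite_imp_inj_to_nat_seg[OF finZ] by blast
  \<comment> \<open>Off the chosen component the value depends only on the component, so adjacent
    vertices share it. The form matches \<open>separated_values\<close>.\<close>
  define \<Phi> where "\<Phi> x = (if x \<in> verts H then int (path_dist H u x)
    else int ?d + 10 * (1 + int (f (scc_of x))))" for x
  have same: "scc_of x = scc_of y" if "x \<rightarrow>\<^bsub>G\<^esub> y" for x y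
    using that by (intro scc_of_eq scc_ofI_reachable reachable_adjI)
  have scc_H: "scc_of x = verts H \<longleftrightarrow> x \<in> verts H" if "x \<in> verts G" for x
  proof
    assume "x \<in> verts H"
    then have "x \<in> scc_of x \<inter> verts H" using in_scc_of_self[OF that] by simp
    then show "scc_of x = verts H"
      using sccs_verts_disjoint[OF scc_of_in_sccs_verts[OF that] HS] by blast
  qed (use in_scc_of_self[OF that] in auto)
  have step: "path_dist H u y \<le> Suc (path_dist H u x)"
    if "x \<in> verts H" "y \<in> verts H" "x \<rightarrow>\<^bsub>G\<^esub> y" for x y
    using path_dist_step[OF wfH reach[OF that(1)]] induced_subgraph_dominates[OF ind that(1,2)] that(3)
    by simp
  have lip: "\<bar>\<Phi> x - \<Phi> y\<bar> \<le> 1" if xy: "x \<rightarrow>\<^bsub>G\<^esub> y" for x y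
  proof -
    have V: "x \<in> verts G" "y \<in> verts G" using adj_in_verts[OF xy] by auto
    have H_iff: "x \<in> verts H \<longleftrightarrow> y \<in> verts H" using scc_H V same[OF xy] by metis
    show ?thesis
    proof (cases "x \<in> verts H")
      case True
      have yx: "y \<rightarrow>\<^bsub>G\<^esub> x" using symD[OF sym xy] .
      show ?thesis using True H_iff step[OF _ _ xy] step[OF _ _ yx] by (simp add: \<Phi>_def)
    next
      case False
      then show ?thesis using H_iff same[OF xy] by (simp add: \<Phi>_def)
    qed
  qed
  have "lipschitz_graph (verts G) (dominates G) \<Phi> s"
  proof (intro lipschitz_graph.intro[OF simple] lipschitz_graph_axioms.intro)
    show "\<bar>\<Phi> x - \<Phi> y\<bar> \<le> 1" if "x \<rightarrow>\<^bsub>G\<^esub> y" for x y using lip[OF that] .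
    show "\<exists>C\<subseteq>verts G. s \<le> card C \<and> (\<forall>c\<in>C. \<Phi> c \<notin> {a..a+3} \<union> {b..b+3})
        \<and> (\<forall>c\<in>C. \<forall>c'\<in>C. c \<noteq> c' \<longrightarrow> 3 \<le> \<bar>\<Phi> c - \<Phi> c'\<bar>)" for a b
    proof (rule separated_values[OF finZ f])
      show "int n \<in> \<Phi> ` verts G" if n: "n \<le> ?d" for n
      proof -
        obtain w where "w \<in> verts H" "path_dist H u w = n"
          using path_dist_values[OF wfH reach[OF uv(2)]] uv(3) n by metis
        then show ?thesis using VH by (intro image_eqI[of _ _ w]) (auto simp: \<Phi>_def)
      qed
      show "int ?d + 10 * (1 + int (f z)) \<in> \<Phi> ` verts G" if z: "z \<in> Z" for z
      proof -
        obtain x where x: "x \<in> verts G" "scc_of x = z" using z by (auto simp: Z_def sccs_verts_conv_scc_of)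
        then have "x \<notin> verts H" using scc_H z by (auto simp: Z_def)
        then show ?thesis using x by (intro image_eqI[of _ _ x]) (auto simp: \<Phi>_def)
      qed
      \<comment> \<open>The ceiling lies strictly below its argument plus one, so three times it is
        less than d - 4. For integers this is at most d - 5, the constant in
        \<open>separated_values\<close>.\<close>
      have "real_of_int \<lceil>(real ?d - 7) / 3\<rceil> < (real ?d - 7) / 3 + 1" by linarith
      then have "real_of_int (3 * \<lceil>(real ?d - 7) / 3\<rceil>) < real_of_int (int ?d - 4)"
        by (simp add: field_simps)
      then have "3 * \<lceil>(real ?d - 7) / 3\<rceil> < int ?d - 4" by (simp only: of_int_less_iff)
      then show "3 * int s \<le> int ?d - 5 + 3 * int (card Z)" using s cardZ by linarith
    qed
  qed
  then show ?thesis using that by blast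
qed

section \<open>Depth\<close>

text \<open>\<open>mideal\<close> lives in the ring in all variables of the type; this is its part
  inside the ring of the theorem.\<close>

definition mideal_in :: "'v set \<Rightarrow> 'v multiset set \<Rightarrow> ('v, 'k::comm_ring_1) mpoly set" where
  "mideal_in V N = carrier (mpoly_ring V) \<inter> mideal N"

lemma carrier_mpoly_ring: "carrier (mpoly_ring V) = mideal {M. set_mset M \<subseteq> V}"
  unfolding mideal_def by (simp add: set_eq_iff mem_carrier_mpoly_ring)

lemma mpoly_ring_a_inv:
  fixes f :: "('v, 'k::comm_ring_1) mpoly"
  assumes "f \<in> carrier (mpoly_ring V)"
  shows "\<ominus>\<^bsub>mpoly_ring V\<^esub> f = - f"
proof -
  interpret cring "mpoly_ring V :: ('v, 'k) mpoly ring" by (rule cring_mpoly_ring)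
  show ?thesis by (rule minus_equality) (use assms in \<open>auto simp: mem_carrier_mpoly_ring\<close>)
qed

lemma ideal_mideal_in:
  assumes "upset N"
  shows "ideal (mideal_in V N) (mpoly_ring V :: ('v, 'k::comm_ring_1) mpoly ring)"
proof -
  interpret cring "mpoly_ring V :: ('v, 'k) mpoly ring" by (rule cring_mpoly_ring)
  show ?thesis
  proof (rule idealI)
    show "ring (mpoly_ring V :: ('v, 'k) mpoly ring)" by (rule ring_axioms)
    show "subgroup (mideal_in V N) (add_monoid (mpoly_ring V :: ('v, 'k) mpoly ring))"
    proof (rule add.subgroupI)
      show "mideal_in V N \<noteq> ({} :: ('v, 'k) mpoly set)" using zero_closed by (auto simp: mideal_in_def)
      show "\<ominus>\<^bsub>mpoly_ring V\<^esub> a \<in> mideal_in V N" if "a \<in> mideal_in V N" for a :: "('v, 'k) mpoly"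
        using that a_inv_closed[of a] by (auto simp: mideal_in_def mpoly_ring_a_inv mideal_uminus)
      show "a \<oplus>\<^bsub>mpoly_ring V\<^esub> b \<in> mideal_in V N" if "a \<in> mideal_in V N" "b \<in> mideal_in V N" for a b :: "('v, 'k) mpoly"
        using that a_closed[of a b] by (auto simp: mideal_in_def mideal_add)
    qed (auto simp: mideal_in_def)
    fix a x :: "('v, 'k) mpoly" assume "a \<in> mideal_in V N" "x \<in> carrier (mpoly_ring V)"
    then show "x \<otimes>\<^bsub>mpoly_ring V\<^esub> a \<in> mideal_in V N" "a \<otimes>\<^bsub>mpoly_ring V\<^esub> x \<in> mideal_in V N"
      using m_closed[of x a] m_closed[of a x] mideal_mult[OF assms]
      by (auto simp: mideal_in_def)
  qed
qed

section \<open>Powers of the edge ideal as monomial ideals\<close>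

lemma poly_mapping_sum_single:
  fixes f :: "'a \<Rightarrow>\<^sub>0 'b::comm_monoid_add"
  shows "(\<Sum>m\<in>Poly_Mapping.keys f. Poly_Mapping.single m (Poly_Mapping.lookup f m)) = f"
  by (rule poly_mapping_eqI) (auto simp: lookup_sum lookup_single when_def in_keys_iff)

lemma mem_if_singles_mem:
  fixes f :: "'a \<Rightarrow>\<^sub>0 'b::comm_monoid_add"
  assumes zero: "0 \<in> S" and add: "\<And>a b. a \<in> S \<Longrightarrow> b \<in> S \<Longrightarrow> a + b \<in> S"
    and single: "\<And>m c. m \<in> Poly_Mapping.keys f \<Longrightarrow> Poly_Mapping.single m c \<in> S"
  shows "f \<in> S"
proof -
  have "(\<Sum>m\<in>A. Poly_Mapping.single m (Poly_Mapping.lookup f m)) \<in> S" if "A \<subseteq> Poly_Mapping.keys f" for A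
    using finite_subset[OF that finite_keys] that
    by (induction A rule: finite_induct) (auto intro: zero add single)
  from this[OF subset_refl] show ?thesis by (simp only: poly_mapping_sum_single)
qed

text \<open>Every term of f is a generator times a term with exponents in V; the coefficient goes
  into the cofactor.\<close>

lemma mideal_in_subset_ideal:
  fixes I :: "('v, 'k::comm_ring_1) mpoly set"
  assumes "ideal I (mpoly_ring V)" and gen: "\<And>L. L \<in> S \<Longrightarrow> monomial L \<in> I"
  shows "mideal_in V (multiples S) \<subseteq> I"
proof
  interpret ideal I "mpoly_ring V :: ('v, 'k) mpoly ring" by fact
  fix f :: "('v, 'k) mpoly" assume f: "f \<in> mideal_in V (multiples S)"
  show "f \<in> I"
  proof (rule mem_if_singles_mem)
    show "0 \<in> I" using additive_subgroup.zero_closed[OF is_additive_subgroup] by simp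
    show "a + b \<in> I" if "a \<in> I" "b \<in> I" for a b using additive_subgroup.a_closed[OF is_additive_subgroup that] by simp
    fix m and c :: 'k assume m: "m \<in> Poly_Mapping.keys f"
    then obtain L where L: "L \<in> S" "L \<subseteq># mset_of m"
      using f by (auto simp: mideal_in_def mideal_def multiples_def)
    have "Poly_Mapping.keys m \<subseteq> V" using f m by (auto simp: mideal_in_def mem_carrier_mpoly_ring)
    then have "set_mset (mset_of m - L) \<subseteq> V"
      using set_mset_mono[OF diff_subset_eq_self[of "mset_of m" L]] by simp
    then have "Poly_Mapping.keys (expo (mset_of m - L)) \<subseteq> V"
      using set_mset_of[of "expo (mset_of m - L)"] by simp
    then have "Poly_Mapping.single (expo (mset_of m - L)) c \<in> carrier (mpoly_ring V)"
      by (simp add: mem_carrier_mpoly_ring)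
    from I_l_closed[OF gen[OF L(1)] this]
    have "Poly_Mapping.single (expo (mset_of m - L) + expo L) c \<in> I"
      by (simp add: monomial_def mult_single)
    moreover have "expo (mset_of m - L) + expo L = m"
      using L(2) by (metis expo_add expo_mset_of subset_mset.diff_add)
    ultimately show "Poly_Mapping.single m c \<in> I" by simp
  qed
qed

text \<open>Monomials of a product are sums of exponents, hence divisible by some A + B; conversely
  A + B is the product of two generators, which lie in the ring because their supports lie in
  V.\<close>

lemma ideal_prod_mideal_in:
  fixes V :: "'v set"
  assumes "\<And>A. A \<in> S \<Longrightarrow> set_mset A \<subseteq> V" "\<And>B. B \<in> S' \<Longrightarrow> set_mset B \<subseteq> V"
  shows "ideal_prod (mpoly_ring V :: ('v, 'k::comm_ring_1) mpoly ring) (mideal_in V (multiples S)) (mideal_in V (multiples S'))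
    = mideal_in V (multiples {A + B | A B. A \<in> S \<and> B \<in> S'})" (is "?P = mideal_in V ?M")
proof
  interpret cring "mpoly_ring V :: ('v, 'k) mpoly ring" by (rule cring_mpoly_ring)
  interpret M: ideal "mideal_in V ?M" "mpoly_ring V :: ('v, 'k) mpoly ring" by (intro ideal_mideal_in upset_multiples)
  show "?P \<subseteq> mideal_in V ?M"
  proof
    fix f assume "f \<in> ?P"
    then show "f \<in> mideal_in V ?M"
    proof (induction rule: ideal_prod.induct)
      case (prod i j)
      have "mset_of k \<in> ?M" if k: "k \<in> Poly_Mapping.keys (i * j)" for k
      proof -
        obtain a b where ab: "k = a + b" "a \<in> Poly_Mapping.keys i" "b \<in> Poly_Mapping.keys j"
          using k keys_mult[of i j] by blast
        have "mset_of a \<in> multiples S" "mset_of b \<in> multiples S'"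
          using prod ab(2,3) by (auto simp: mideal_in_def mideal_def)
        then obtain A B where "A \<in> S" "A \<subseteq># mset_of a" "B \<in> S'" "B \<subseteq># mset_of b"
          unfolding multiples_def by blast
        then show ?thesis
          using subset_mset.add_mono[of A "mset_of a" B "mset_of b"] ab(1)
          by (auto simp: multiples_def)
      qed
      moreover have "i * j \<in> carrier (mpoly_ring V)"
        using m_closed[of i j] prod by (simp add: mideal_in_def)
      ultimately show ?case by (simp add: mideal_in_def mideal_def)
    next
      case (sum s1 s2)
      then show ?case by (intro M.a_closed)
    qed
  qed
  show "mideal_in V ?M \<subseteq> ?P"
  proof (rule mideal_in_subset_ideal)
    show "ideal ?P (mpoly_ring V :: ('v, 'k) mpoly ring)"
      by (intro ideal_prod_is_ideal ideal_mideal_in upset_multiples)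
    fix L assume "L \<in> {A + B | A B. A \<in> S \<and> B \<in> S'}"
    then obtain A B where L: "L = A + B" "A \<in> S" "B \<in> S'" by blast
    have mem: "(monomial A :: ('v, 'k) mpoly) \<in> mideal_in V (multiples S)"
      if "A \<in> S" "set_mset A \<subseteq> V" for A and S :: "'v multiset set"
      using that monomial_in_mideal[of A "multiples S"] monomial_in_mideal[of A "{M. set_mset M \<subseteq> V}"]
      by (auto simp: mideal_in_def carrier_mpoly_ring multiples_def)
    show "monomial L \<in> ?P"
      unfolding L(1) monomial_add
      using ideal_prod.prod[OF mem[OF L(2) assms(1)[OF L(2)]] mem[OF L(3) assms(2)[OF L(3)]],
          of "mpoly_ring V"] by simp
  qed
qed

lemma edge_ideal_eq:
  fixes G :: "('v, 'e) pre_digraph"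
  assumes "simple_graph (verts G) (dominates G)"
  shows "(edge_ideal G :: ('v, 'k::comm_ring_1) mpoly set) = mideal_in (verts G) (multiples (simple_graph.products (dominates G) (Suc 0)))"
proof -
  interpret simple_graph "verts G" "dominates G" by fact
  interpret cring "mpoly_ring (verts G) :: ('v, 'k) mpoly ring" by (rule cring_mpoly_ring)
  let ?X = "{var u * var v | u v. u \<rightarrow>\<^bsub>G\<^esub> v} :: ('v, 'k) mpoly set"
  have var2: "var u * var v = (monomial {#u, v#} :: ('v, 'k) mpoly)" for u v
  proof -
    have "expo {#u, v#} = Poly_Mapping.single u 1 + Poly_Mapping.single v 1"
      by (rule poly_mapping_eqI) (simp add: lookup_add lookup_single when_def)
    then show ?thesis by (simp add: var_def monomial_def mult_single)
  qed
  have mem: "(monomial {#u, v#} :: ('v, 'k) mpoly) \<in> mideal_in (verts G) (multiples (products (Suc 0)))"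
    if "u \<rightarrow>\<^bsub>G\<^esub> v" for u v
    using that monomial_in_mideal[of "{#u, v#}" "multiples (products (Suc 0))"]
      monomial_in_mideal[of "{#u, v#}" "{M. set_mset M \<subseteq> verts G}"] E_V[OF that] E_V[OF E_sym[OF that]]
    by (auto simp: mideal_in_def carrier_mpoly_ring multiples_def)
  then have sub: "?X \<subseteq> mideal_in (verts G) (multiples (products (Suc 0)))" by (auto simp: var2)
  then have carr: "?X \<subseteq> carrier (mpoly_ring (verts G))" by (auto simp: mideal_in_def)
  show ?thesis
    unfolding edge_ideal_def
  proof
    show "Idl\<^bsub>mpoly_ring (verts G)\<^esub> ?X \<subseteq> mideal_in (verts G) (multiples (products (Suc 0)))"
      by (intro genideal_minimal ideal_mideal_in upset_multiples sub)
    show "mideal_in (verts G) (multiples (products (Suc 0))) \<subseteq> Idl\<^bsub>mpoly_ring (verts G)\<^esub> ?X"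
    proof (rule mideal_in_subset_ideal[OF genideal_ideal[OF carr]])
      fix L assume "L \<in> products (Suc 0)"
      then have "monomial L \<in> ?X" unfolding products_1 var2 by blast
      then show "monomial L \<in> Idl\<^bsub>mpoly_ring (verts G)\<^esub> ?X" using genideal_self[OF carr] by blast
    qed
  qed
qed

lemma edge_ideal_power:
  fixes G :: "('v, 'e) pre_digraph"
  assumes "simple_graph (verts G) (dominates G)"
  shows "(edge_ideal G :: ('v, 'k::comm_ring_1) mpoly set) [^]\<^bsub>ideals_set (mpoly_ring (verts G))\<^esub> (n::nat)
    = mideal_in (verts G) (multiples (simple_graph.products (dominates G) n))"
proof -
  interpret simple_graph "verts G" "dominates G" by fact
  show ?thesis
  proof (induction n)
    case 0
    show ?case by (auto simp: ideals_set_def mideal_in_def mideal_def multiples_def)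
  next
    case (Suc n)
    have "{A + B | A B. A \<in> products n \<and> B \<in> products (Suc 0)} = products (Suc n)"
    proof (intro equalityI subsetI)
      fix M assume "M \<in> {A + B | A B. A \<in> products n \<and> B \<in> products (Suc 0)}"
      then obtain A u v where "A \<in> products n" "M = {#u, v#} + A" "u \<rightarrow>\<^bsub>G\<^esub> v"
        unfolding products_1 by (auto simp: add.commute)
      then show "M \<in> products (Suc n)" by auto
    next
      fix M assume "M \<in> products (Suc n)"
      then obtain A u v where "A \<in> products n" "M = A + {#u, v#}" "u \<rightarrow>\<^bsub>G\<^esub> v" by auto
      then show "M \<in> {A + B | A B. A \<in> products n \<and> B \<in> products (Suc 0)}"
        unfolding products_1 by blast
    qed
    then show ?case
      using Suc ideal_prod_mideal_in[of "products n" "verts G" "products (Suc 0)"] products_V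
      by (simp add: edge_ideal_eq[OF assms] ideals_set_def del: products.simps)
  qed
qed

section \<open>From regularity modulo monomials to regular sequences on the quotient module\<close>

lemma finsum_quotient_module:
  "finsum (quotient_module R J) = finsum (R Quot J)"
  by (intro ext) (simp add: finsum_def finprod_def)

text \<open>Module elements are cosets and forming cosets is a ring homomorphism, so sums and
  scalars move inside the coset. The coefficients become polynomials, to which
  \<open>ideal_ext\<close> can be compared.\<close>

lemma seq_submodule_quotient_module:
  fixes J :: "('v, 'k::comm_ring_1) mpoly set"
  assumes J: "ideal J (mpoly_ring V)" and fs: "set fs \<subseteq> carrier (mpoly_ring V)"
  shows "seq_submodule (quotient_module (mpoly_ring V) J) fs =
    {J +>\<^bsub>mpoly_ring V\<^esub> (\<Sum>j<length fs. fs ! j * h j) | h. \<forall>j. h j \<in> carrier (mpoly_ring V)}"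
proof -
  let ?R = "mpoly_ring V :: ('v, 'k) mpoly ring"
  interpret R: cring ?R by (rule cring_mpoly_ring)
  interpret J: ideal J ?R by (rule J)
  interpret Q: cring "?R Quot J" by (rule J.quotient_is_cring[OF R.is_cring])
  interpret h: ring_hom_ring ?R "?R Quot J" "(+>\<^bsub>?R\<^esub>) J" by (rule J.rcos_ring_hom_ring)
  have fsj: "fs ! j \<in> carrier ?R" if "j < length fs" for j using fs that by auto
  have sum: "(\<Oplus>\<^bsub>?R Quot J\<^esub>j\<in>{..<n}. J +>\<^bsub>?R\<^esub> g j) = J +>\<^bsub>?R\<^esub> (\<Sum>j<n. g j) \<and> (\<Sum>j<n. g j) \<in> carrier ?R"
    if "\<And>j. j < n \<Longrightarrow> g j \<in> carrier ?R" for n and g :: "nat \<Rightarrow> ('v, 'k) mpoly"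
    using that
  proof (induction n)
    case 0
    then show ?case using h.hom_zero R.zero_closed by simp
  next
    case (Suc n)
    have gn: "g n \<in> carrier ?R" using Suc.prems by simp
    have "(\<Oplus>\<^bsub>?R Quot J\<^esub>j\<in>insert n {..<n}. J +>\<^bsub>?R\<^esub> g j)
        = (J +>\<^bsub>?R\<^esub> g n) \<oplus>\<^bsub>?R Quot J\<^esub> (\<Oplus>\<^bsub>?R Quot J\<^esub>j\<in>{..<n}. J +>\<^bsub>?R\<^esub> g j)"
      by (rule Q.finsum_insert) (use Suc.prems h.hom_closed in auto)
    then show ?case
      using Suc h.hom_add[OF gn, of "\<Sum>j<n. g j"] R.a_closed[OF gn, of "\<Sum>j<n. g j"]
      by (simp add: lessThan_Suc add.commute)
  qed
  have smult: "(\<Oplus>\<^bsub>?R Quot J\<^esub>j\<in>{..<length fs}. (J +>\<^bsub>?R\<^esub> fs ! j) \<otimes>\<^bsub>?R Quot J\<^esub> x j)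
      = J +>\<^bsub>?R\<^esub> (\<Sum>j<length fs. fs ! j * h j)"
    if x: "\<And>j. j < length fs \<Longrightarrow> x j = J +>\<^bsub>?R\<^esub> h j" "\<And>j. j < length fs \<Longrightarrow> h j \<in> carrier ?R" for x h
  proof -
    have prod: "fs ! j * h j \<in> carrier ?R" if "j < length fs" for j
      using R.m_closed[OF fsj[OF that] x(2)[OF that]] by simp
    have "(\<Oplus>\<^bsub>?R Quot J\<^esub>j\<in>{..<length fs}. (J +>\<^bsub>?R\<^esub> fs ! j) \<otimes>\<^bsub>?R Quot J\<^esub> x j)
        = (\<Oplus>\<^bsub>?R Quot J\<^esub>j\<in>{..<length fs}. J +>\<^bsub>?R\<^esub> (fs ! j * h j))"
    proof (rule Q.finsum_cong')
      show "(\<lambda>j. J +>\<^bsub>?R\<^esub> (fs ! j * h j)) \<in> {..<length fs} \<rightarrow> carrier (?R Quot J)"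
        using prod h.hom_closed by auto
      show "(J +>\<^bsub>?R\<^esub> fs ! j) \<otimes>\<^bsub>?R Quot J\<^esub> x j = J +>\<^bsub>?R\<^esub> (fs ! j * h j)" if "j \<in> {..<length fs}" for j
        using h.hom_mult[OF fsj x(2), of j j] x(1)[of j] that by simp
    qed simp
    then show ?thesis using sum[OF prod] by simp
  qed
  have Q_elem: "\<exists>h. X = J +>\<^bsub>?R\<^esub> h \<and> h \<in> carrier ?R" if "X \<in> carrier (?R Quot J)" for X
    using that by (auto simp: FactRing_def A_RCOSETS_def')
  show ?thesis
    unfolding seq_submodule_def finsum_quotient_module quotient_module_simps
  proof (intro equalityI subsetI)
    fix Y
    assume "Y \<in> {\<Oplus>\<^bsub>?R Quot J\<^esub>j\<in>{..<length fs}. (J +>\<^bsub>?R\<^esub> fs ! j) \<otimes>\<^bsub>?R Quot J\<^esub> x j | x.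
      x \<in> {..<length fs} \<rightarrow> carrier (?R Quot J)}"
    then obtain x where x: "x \<in> {..<length fs} \<rightarrow> carrier (?R Quot J)"
      "Y = (\<Oplus>\<^bsub>?R Quot J\<^esub>j\<in>{..<length fs}. (J +>\<^bsub>?R\<^esub> fs ! j) \<otimes>\<^bsub>?R Quot J\<^esub> x j)" by blast
    have "\<forall>j. \<exists>h. h \<in> carrier ?R \<and> (j < length fs \<longrightarrow> x j = J +>\<^bsub>?R\<^esub> h)"
    proof
      fix j show "\<exists>h. h \<in> carrier ?R \<and> (j < length fs \<longrightarrow> x j = J +>\<^bsub>?R\<^esub> h)"
        using Q_elem[of "x j"] x(1) R.zero_closed by (cases "j < length fs") auto
    qed
    then obtain h where h: "\<And>j. h j \<in> carrier ?R" "\<And>j. j < length fs \<Longrightarrow> x j = J +>\<^bsub>?R\<^esub> h j" by metis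
    then have "Y = J +>\<^bsub>?R\<^esub> (\<Sum>j<length fs. fs ! j * h j)"
      using smult[of x h] x(2) by simp
    then show "Y \<in> {J +>\<^bsub>?R\<^esub> (\<Sum>j<length fs. fs ! j * h j) | h. \<forall>j. h j \<in> carrier ?R}"
      using h(1) by (intro CollectI exI[of _ h]) simp
  next
    fix Y assume "Y \<in> {J +>\<^bsub>?R\<^esub> (\<Sum>j<length fs. fs ! j * h j) | h. \<forall>j. h j \<in> carrier ?R}"
    then obtain h where h: "\<And>j. h j \<in> carrier ?R" "Y = J +>\<^bsub>?R\<^esub> (\<Sum>j<length fs. fs ! j * h j)" by blast
    have "(\<lambda>j. J +>\<^bsub>?R\<^esub> h j) \<in> {..<length fs} \<rightarrow> carrier (?R Quot J)" using h(1) h.hom_closed by auto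
    moreover have "Y = (\<Oplus>\<^bsub>?R Quot J\<^esub>j\<in>{..<length fs}. (J +>\<^bsub>?R\<^esub> fs ! j) \<otimes>\<^bsub>?R Quot J\<^esub> (J +>\<^bsub>?R\<^esub> h j))"
      using smult[of "\<lambda>j. J +>\<^bsub>?R\<^esub> h j" h] h by simp
    ultimately show "Y \<in> {\<Oplus>\<^bsub>?R Quot J\<^esub>j\<in>{..<length fs}. (J +>\<^bsub>?R\<^esub> fs ! j) \<otimes>\<^bsub>?R Quot J\<^esub> x j | x.
      x \<in> {..<length fs} \<rightarrow> carrier (?R Quot J)}"
      by (intro CollectI exI[of _ "\<lambda>j. J +>\<^bsub>?R\<^esub> h j"] conjI)
  qed
qed

lemma mpoly_coset_eq_iff:
  fixes J :: "('v, 'k::comm_ring_1) mpoly set"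
  assumes J: "ideal J (mpoly_ring V)" and "a \<in> carrier (mpoly_ring V)" "b \<in> carrier (mpoly_ring V)"
  shows "J +>\<^bsub>mpoly_ring V\<^esub> a = J +>\<^bsub>mpoly_ring V\<^esub> b \<longleftrightarrow> a - b \<in> J"
proof -
  interpret R: cring "mpoly_ring V :: ('v, 'k) mpoly ring" by (rule cring_mpoly_ring)
  show ?thesis
    using R.quotient_eq_iff_same_a_r_cos[OF assms]
    by (simp add: R.minus_eq mpoly_ring_a_inv[OF assms(3)])
qed

lemma sum_closed_mpoly_ring:
  fixes g h :: "nat \<Rightarrow> ('v, 'k::comm_ring_1) mpoly"
  assumes "\<And>j. j < n \<Longrightarrow> g j \<in> carrier (mpoly_ring V)" "\<And>j. h j \<in> carrier (mpoly_ring V)"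
  shows "(\<Sum>j<n. g j * h j) \<in> carrier (mpoly_ring V)"
proof -
  interpret R: cring "mpoly_ring V :: ('v, 'k) mpoly ring" by (rule cring_mpoly_ring)
  have "g j * h j \<in> carrier (mpoly_ring V)" if "j < n" for j
    using R.m_closed[OF assms(1)[OF that] assms(2)[of j]] by simp
  then show ?thesis unfolding carrier_mpoly_ring by (intro mideal_sum) auto
qed

text \<open>
  Restricting to the monomials in \<open>V\<close> carries the regularity over from polynomials in all
  variables, modulo those outside \<open>V\<close>, to \<open>mpoly_ring V\<close>.
\<close>

lemma regular_sequence_mideal_in:
  fixes g :: "nat \<Rightarrow> ('v, 'k::comm_ring_1) mpoly"
  assumes N: "upset N" "{#} \<notin> N" and g: "\<And>i. i < s \<Longrightarrow> g i \<in> mideal_in V {M. M \<noteq> {#}}"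
    and reg: "regular_mod g s (nonface V \<union> N)"
  shows "regular_sequence (quotient_module (mpoly_ring V) (mideal_in V N)) (map g [0..<s])"
proof -
  let ?R = "mpoly_ring V :: ('v, 'k) mpoly ring"
  let ?J = "mideal_in V N :: ('v, 'k) mpoly set"
  interpret R: cring ?R by (rule cring_mpoly_ring)
  have J: "ideal ?J ?R" by (rule ideal_mideal_in[OF N(1)])
  interpret J: ideal ?J ?R by (rule J)
  interpret h: ring_hom_ring ?R "?R Quot ?J" "(+>\<^bsub>?R\<^esub>) ?J" by (rule J.rcos_ring_hom_ring)
  have gR: "g i \<in> carrier ?R" if "i < s" for i using g[OF that] by (simp add: mideal_in_def)
  have sub: "seq_submodule (quotient_module ?R ?J) (take i (map g [0..<s])) =
      {?J +>\<^bsub>?R\<^esub> (\<Sum>j<i. g j * h j) | h. \<forall>j. h j \<in> carrier ?R}" if i: "i \<le> s" for i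
  proof -
    have eq: "take i (map g [0..<s]) = map g [0..<i]" using i by (simp add: take_map)
    have "set (map g [0..<i]) \<subseteq> carrier ?R" using gR i by auto
    from seq_submodule_quotient_module[OF J this] show ?thesis unfolding eq by simp
  qed
  have key: "?J +>\<^bsub>?R\<^esub> f \<in> seq_submodule (quotient_module ?R ?J) (take i (map g [0..<s]))"
    if i: "i < s" and f: "f \<in> carrier ?R" and mem: "?J +>\<^bsub>?R\<^esub> (g i * f) \<in>
      seq_submodule (quotient_module ?R ?J) (take i (map g [0..<s]))" for i f
  proof -
    have il: "i \<le> s" using i by simp
    obtain h where h: "\<And>j. h j \<in> carrier ?R" "?J +>\<^bsub>?R\<^esub> (g i * f) = ?J +>\<^bsub>?R\<^esub> (\<Sum>j<i. g j * h j)"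
      using mem unfolding sub[OF il] by blast
    have "(\<Sum>j<i. g j * h j) \<in> carrier ?R" by (rule sum_closed_mpoly_ring) (use gR h(1) i in auto)
    moreover have "g i * f \<in> carrier ?R" using R.m_closed[OF gR[OF i] f] by simp
    ultimately have "g i * f - (\<Sum>j<i. g j * h j) \<in> ?J" using h(2) mpoly_coset_eq_iff[OF J] by blast
    then have "g i * f - (\<Sum>j<i. g j * h j) \<in> mideal (nonface V \<union> N)"
      by (auto simp: mideal_in_def mideal_def)
    from ideal_extI[OF this, of g h i] have "g i * f \<in> ideal_ext g (nonface V \<union> N) i" by simp
    then have "f \<in> ideal_ext g (nonface V \<union> N) i" using reg i by (simp add: regular_mod_def)
    then obtain q k where q: "q \<in> mideal (nonface V \<union> N)" and fq: "f = q + (\<Sum>j<i. g j * k j)"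
      unfolding ideal_ext_def by blast
    \<comment> \<open>Projection to the polynomials in V: it commutes with multiplication by each
      \<open>g j\<close>, fixes f, and removes from q the monomials that are only there because of
      \<open>nonface V\<close>.\<close>
    let ?r = "restrict_keys (\<lambda>m. Poly_Mapping.keys m \<subseteq> V) :: ('v, 'k) mpoly \<Rightarrow> ('v, 'k) mpoly"
    have keys_plus: "Poly_Mapping.keys (a + b) = Poly_Mapping.keys a \<union> Poly_Mapping.keys b"
      for a b :: "'v \<Rightarrow>\<^sub>0 nat"
      by (auto simp: in_keys_iff lookup_add)
    have "?r (g j * k j) = g j * ?r (k j)" if "j < i" for j
      by (rule restrict_keys_mult)
        (use gR[of j] that i in \<open>auto simp: keys_plus mem_carrier_mpoly_ring\<close>)
    then have "?r f = ?r q + (\<Sum>j<i. g j * ?r (k j))"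
      by (simp add: fq restrict_keys_add restrict_keys_sum)
    moreover have "?r f = f"
      by (rule restrict_keys_id) (use f in \<open>simp add: mem_carrier_mpoly_ring\<close>)
    ultimately have f': "f - (\<Sum>j<i. g j * ?r (k j)) = ?r q" by (simp add: algebra_simps)
    have rR: "?r c \<in> carrier ?R" for c by (simp add: mem_carrier_mpoly_ring keys_restrict_keys)
    have "?r q \<in> ?J"
      using q rR[of q] by (auto simp: mideal_in_def mideal_def keys_restrict_keys nonface_def)
    moreover have "(\<Sum>j<i. g j * ?r (k j)) \<in> carrier ?R"
      by (rule sum_closed_mpoly_ring) (use gR rR i in auto)
    ultimately have "?J +>\<^bsub>?R\<^esub> f = ?J +>\<^bsub>?R\<^esub> (\<Sum>j<i. g j * ?r (k j))"
      using mpoly_coset_eq_iff[OF J f] f' by simp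
    then show ?thesis
      unfolding sub[OF il] using rR by (intro CollectI exI[of _ "\<lambda>j. ?r (k j)"]) simp
  qed
  have Q_elem: "\<exists>f. X = ?J +>\<^bsub>?R\<^esub> f \<and> f \<in> carrier ?R" if "X \<in> carrier (?R Quot ?J)" for X
    using that by (auto simp: FactRing_def A_RCOSETS_def')
  show ?thesis
    unfolding regular_sequence_def
  proof (intro conjI allI impI ballI)
    fix i X
    assume i: "i < length (map g [0..<s])" and X: "X \<in> carrier (quotient_module ?R ?J)"
      and mem: "(map g [0..<s] ! i) \<odot>\<^bsub>quotient_module ?R ?J\<^esub> X \<in>
        seq_submodule (quotient_module ?R ?J) (take i (map g [0..<s]))"
    obtain f where f: "X = ?J +>\<^bsub>?R\<^esub> f" "f \<in> carrier ?R" using Q_elem X by auto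
    have "i < s" using i by simp
    then have "(map g [0..<s] ! i) \<odot>\<^bsub>quotient_module ?R ?J\<^esub> X = ?J +>\<^bsub>?R\<^esub> (g i * f)"
      using h.hom_mult[OF gR f(2), of i] f(1) by simp
    then show "X \<in> seq_submodule (quotient_module ?R ?J) (take i (map g [0..<s]))"
      using key[OF \<open>i < s\<close> f(2)] mem f(1) by simp
  next
    show "seq_submodule (quotient_module ?R ?J) (map g [0..<s]) \<noteq> carrier (quotient_module ?R ?J)"
    proof
      assume eq: "seq_submodule (quotient_module ?R ?J) (map g [0..<s]) = carrier (quotient_module ?R ?J)"
      have "?J +>\<^bsub>?R\<^esub> 1 \<in> carrier (quotient_module ?R ?J)"
        using h.hom_closed[OF R.one_closed] by simp
      then have "?J +>\<^bsub>?R\<^esub> 1 \<in> seq_submodule (quotient_module ?R ?J) (take s (map g [0..<s]))"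
        using eq by simp
      then obtain h where h: "\<And>j. h j \<in> carrier ?R" "?J +>\<^bsub>?R\<^esub> 1 = ?J +>\<^bsub>?R\<^esub> (\<Sum>j<s. g j * h j)"
        unfolding sub[OF order_refl] by blast
      have "(\<Sum>j<s. g j * h j) \<in> carrier ?R" by (rule sum_closed_mpoly_ring) (use gR h(1) in auto)
      then have "1 - (\<Sum>j<s. g j * h j) \<in> ?J"
        using h(2) mpoly_coset_eq_iff[OF J] R.one_closed by simp
      \<comment> \<open>Neither N nor the \<open>g j\<close> contribute a constant term, so 1 would
        have none.\<close>
      then have "1 - (\<Sum>j<s. g j * h j) \<in> mideal {M. M \<noteq> {#}}"
        using N(2) by (auto simp: mideal_in_def mideal_def)
      moreover have "(\<Sum>j<s. g j * h j) \<in> mideal {M. M \<noteq> {#}}"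
        using g by (intro mideal_sum mideal_mult(2)) (auto simp: upset_def mideal_in_def)
      ultimately have "1 \<in> (mideal {M. M \<noteq> {#}} :: ('v, 'k) mpoly set)"
        using mideal_add by fastforce
      then show False by (simp add: mideal_def)
    qed
  qed
qed

lemma maximal_ideal_supset:
  fixes V :: "'v set"
  shows "mideal_in V {M. M \<noteq> {#}} \<subseteq> Idl\<^bsub>mpoly_ring V\<^esub> (var ` V :: ('v, 'k::comm_ring_1) mpoly set)"
proof -
  interpret R: cring "mpoly_ring V :: ('v, 'k) mpoly ring" by (rule cring_mpoly_ring)
  have var: "var v = (monomial {#v#} :: ('v, 'k) mpoly)" for v
  proof -
    have "expo {#v#} = Poly_Mapping.single v 1"
      by (rule poly_mapping_eqI) (simp add: lookup_single when_def)
    then show ?thesis by (simp add: var_def monomial_def)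
  qed
  have carr: "var ` V \<subseteq> carrier (mpoly_ring V :: ('v, 'k) mpoly ring)"
    unfolding carrier_mpoly_ring by (auto simp: var intro!: monomial_in_mideal)
  have "mideal_in V {M. M \<noteq> {#}} \<subseteq> (mideal_in V (multiples {{#v#} | v. v \<in> V}) :: ('v, 'k) mpoly set)"
    unfolding mideal_in_def carrier_mpoly_ring mideal_def multiples_def by fastforce
  also have "\<dots> \<subseteq> Idl\<^bsub>mpoly_ring V\<^esub> (var ` V)"
  proof (rule mideal_in_subset_ideal[OF R.genideal_ideal[OF carr]])
    fix L :: "'v multiset" assume "L \<in> {{#v#} | v. v \<in> V}"
    then have "monomial L \<in> (var ` V :: ('v, 'k) mpoly set)" by (auto simp: var)
    then show "monomial L \<in> Idl\<^bsub>mpoly_ring V\<^esub> (var ` V :: ('v, 'k) mpoly set)"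
      using R.genideal_self[OF carr] by blast
  qed
  finally show ?thesis .
qed

text \<open>The shift to \<open>Suc i\<close> skips the zeroth symmetric polynomial, which is 1;
  every later one has only nonconstant monomials.\<close>

lemma esym_mem:
  assumes "finite V"
  shows "esym V (Suc i) \<in> mideal_in V {M. M \<noteq> {#}}"
proof -
  have "set_mset (mset_of m) \<subseteq> V \<and> mset_of m \<noteq> {#}"
    if m: "m \<in> Poly_Mapping.keys (esym V (Suc i) :: ('a, 'b) mpoly)" for m
  proof -
    obtain A where A: "A \<subseteq> V" "card A = Suc i" "mset_of m = mset_set A"
      using keys_esym[OF assms m] .
    then have "finite A" by (simp add: card_ge_0_finite)
    then show ?thesis using A by (auto simp: mset_set_empty_iff)
  qed
  then show ?thesis by (simp add: mideal_in_def carrier_mpoly_ring mideal_def)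
qed

theorem theorem4p13:
  fixes G :: "('v, 'e) pre_digraph"
    and R :: "(('v \<Rightarrow>\<^sub>0 nat) \<Rightarrow>\<^sub>0 'k::field) ring"
    and I \<mm> :: "(('v \<Rightarrow>\<^sub>0 nat) \<Rightarrow>\<^sub>0 'k) set"
    and d p :: nat
  assumes "graph G"
    and "verts G \<noteq> {}"
    and "\<forall>v\<in>verts G. \<exists>u. v \<rightarrow>\<^bsub>G\<^esub> u"
  defines "R \<equiv> mpoly_ring (verts G)"
    and "I \<equiv> edge_ideal G"
    and "\<mm> \<equiv> Idl\<^bsub>R\<^esub> (var ` verts G)"
    and "d \<equiv> graph_diameter G"
    and "p \<equiv> card (pre_digraph.sccs G)"
  shows "ereal_of_enat (depth \<mm> (quotient_module R (I [^]\<^bsub>ideals_set R\<^esub> (3::nat))))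
           \<ge> ereal (real_of_int (\<lceil>(real d - 7) / 3\<rceil> + int p - 1))"
proof -
  let ?b = "\<lceil>(real d - 7) / 3\<rceil> + int p - 1"
  let ?M = "quotient_module R (I [^]\<^bsub>ideals_set R\<^esub> (3::nat))"
  \<comment> \<open>A negative bound is replaced by 0, for which the estimate is trivial; in either
    case s is at least the bound.\<close>
  define s where "s = nat ?b"
  have "enat s \<le> depth \<mm> ?M"
  proof (cases "0 \<le> ?b")
    case False
    then show ?thesis by (simp add: s_def zero_enat_def[symmetric])
  next
    case True
    then have "int s \<le> \<lceil>(real (graph_diameter G) - 7) / 3\<rceil> + int (card (pre_digraph.sccs G)) - 1"
      by (simp add: s_def d_def p_def)
    then obtain \<Phi> where "lipschitz_graph (verts G) (dominates G) \<Phi> s"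
      by (rule graph_potential[OF assms(1,2)])
    then interpret lipschitz_graph "verts G" "dominates G" \<Phi> s .
    let ?g = "\<lambda>i. esym (verts G) (Suc i) :: ('v, 'k) mpoly"
    have M: "?M = quotient_module (mpoly_ring (verts G)) (mideal_in (verts G) (multiples (products 3)))"
      unfolding R_def I_def by (simp only: edge_ideal_power[OF simple_graph_axioms])
    have "regular_sequence ?M (map ?g [0..<s])"
      unfolding M
    proof (rule regular_sequence_mideal_in[OF upset_multiples])
      show "{#} \<notin> multiples (products 3)"
        by (auto simp: multiples_def numeral_3_eq_3)
      show "regular_mod ?g s (nonface (verts G) \<union> multiples (products 3))"
        using regular_mod_power_set_3 unfolding power_set_def .
    qed (rule esym_mem[OF finite_V])
    moreover have "set (map ?g [0..<s]) \<subseteq> \<mm>"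
      using maximal_ideal_supset[of "verts G"] esym_mem[OF finite_V] unfolding \<mm>_def R_def by fastforce
    ultimately show ?thesis
      unfolding depth_def by (intro Sup_upper CollectI exI[of _ "map ?g [0..<s]"]) simp
  qed
  then have "ereal (real s) \<le> ereal_of_enat (depth \<mm> ?M)"
    using ereal_of_enat_le_iff[of "enat s"] by simp
  moreover have "real_of_int ?b \<le> real s" by (simp add: s_def)
  ultimately show ?thesis by (meson ereal_less_eq(3) order_trans)
qed

end
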